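(* Let $\mathbf F$ be a field and fix any multigrading $g=(r_1,\dots,r_k)$, with $0\le r_1\le\dots\le r_k$ integers. The assignment $[n]\mapsto\mathbf F[\mathcal B_n]_g$, with the $H_n(0)$-action and the action of the morphisms $\iota_{n,n+1}$ restricted from $\mathbf F[\mathcal B_n]$ (as given in the context), defines an $\mathcal H$-module that is finitely generated.
   Context: The base field is $\mathbf k=\mathbf F$. For $n\ge 0$ let $[n]=\{1,\dots,n\}$, and let $H_n(0)$ be the unital associative $\mathbf k$-algebra generated by $\pi_1,\dots,\pi_{n-1}$ with relations $\pi_i^2=\pi_i$, $\pi_i\pi_{i+1}\pi_i=\pi_{i+1}\pi_i\pi_{i+1}$, and $\pi_i\pi_j=\pi_j\pi_i$ for $|i-j|>1$. For $w\in\mathfrak S_n$ with reduced expression $w=s_{i_1}\cdots s_{i_r}$ in the adjacent transpositions $s_i=(i,i+1)$, put $\pi_w=\pi_{i_1}\cdots\pi_{i_r}$; the $\pi_w$ form a basis of $H_n(0)$ and a monoid $\mathcal M_n$ under multiplication. For $n\le m$, $\mathcal M_n\subseteq\mathcal M_m$ via $\pi_i\mapsto\pi_i$. The $0$-Hecke category $\mathcal H$ has objects $[n]$, $n\ge0$. For $n\le m$, $\mathrm{Hom}_{\mathcal H}([n],[m])$ is the set of braid diagrams from $n$ top vertices to $m$ bottom vertices with only positive crossings, modulo $\pi_i^2=\pi_i$, composed by padding with dummy strands, multiplying in the $0$-Hecke monoid and deleting dummy strands; there are no morphisms if $n>m$. Algebraically, $\mathrm{Hom}_{\mathcal H}([n],[m])$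 is the quotient of $\mathcal M_m$ by the equivalence relation generated by $x\sim x\pi_j$ for $n+1\le j\le m-1$, and the composite of the class of $y\in\mathcal M_\ell$ in $\mathrm{Hom}([m],[\ell])$ with the class of $x\in\mathcal M_m$ in $\mathrm{Hom}([n],[m])$ is the class of $yx\in\mathcal M_\ell$. The principal injection $\iota_{n,m}$ is the class of $1$. An $\mathcal H$-module is a functor $V$ from $\mathcal H$ to $\mathbf k$-vector spaces; $V_n=V([n])$ is an $H_n(0)$-module since $\mathrm{End}_{\mathcal H}([n])=\mathcal M_n$. It is finitely generated if finitely many elements are contained in no proper submodule. $\mathcal B_n$ is the poset of all subsets of $[n]$ ordered by inclusion. $\mathbf F[\mathcal B_n]=\mathbf F[y_A\mid A\subseteq[n]]/\langle y_Ay_B\mid A,B\text{ incomparable}\rangle$; it has $\mathbf F$-basis the monomials $y_M=y_{A_1}\cdots y_{A_k}$ indexed by multichains $M=(A_1\subseteq\dots\subseteq A_k)$ of subsets of $[n]$. With the conventions $A_0=\emptyset$ and $A_{k+1}=[n]$, put $p_i(M)=\min\{j\in[k+1]\mid i\in A_j\}$ for $i\in[n]$. $H_n(0)$ acts by $\pi_i(y_M)=0$ if $p_i(M)>p_{i+1}(M)$, $\pi_i(y_M)=y_M$ if $p_i(M)=p_{i+1}(M)$, and $\pi_i(y_M)=s_i(y_M)+y_M$ if $p_i(M)<p_{i+1}(M)$, where $s_i(y_M)=y_{s_i(M)}$ with $s_i=(i,i+1)$ applied to every set in the multichain. The morphism $\iota_{n,n+1}$ sends the basis element of a multichain in $\mathcal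 B_n$ to the basis element of the same multichain in $\mathcal B_{n+1}$. A multichain $A_1\subseteq\dots\subseteq A_k$ has multigrading $g=(r_1,\dots,r_k)$ if $|A_j|=r_j$ for all $j$, and $\mathbf F[\mathcal B_n]_g$ is the span of the $y_M$ with $M$ of multigrading $g$. *)

theory Defs
  imports
    "HOL-Algebra.Module"
    "HOL-Algebra.QuotRing"
    "HOL-Algebra.Algebraic_Closure_Type"
    "HOL-Library.Poly_Mapping"
    "HOL-Combinatorics.Permutations"
begin

text \<open>
  The base field is a type \<open>'f :: field\<close>; wherever the algebra library wants a record for it,
  \<open>ring_of_type_algebra :: 'f ring\<close> is used. Vector spaces are modules over that record.
\<close>

definition linear_maps :: "('f::field, 'a) module \<Rightarrow> ('f, 'b) module \<Rightarrow> ('a \<Rightarrow> 'b) set" where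
  "linear_maps V W = {T \<in> carrier V \<rightarrow> carrier W.
     (\<forall>u\<in>carrier V. \<forall>v\<in>carrier V. T (u \<oplus>\<^bsub>V\<^esub> v) = T u \<oplus>\<^bsub>W\<^esub> T v) \<and>
     (\<forall>c. \<forall>v\<in>carrier V. T (c \<odot>\<^bsub>V\<^esub> v) = c \<odot>\<^bsub>W\<^esub> T v)}"

definition linear_span :: "('f::field, 'a) module \<Rightarrow> 'a set \<Rightarrow> 'a set" where
  "linear_span V S = \<Inter>{W. submodule W (ring_of_type_algebra :: 'f ring) V \<and> S \<subseteq> W}"

text \<open>
  Both algebras below are quotients of rings of finitely supported functions, in which
  \<open>Poly_Mapping.single 0 c\<close> is the constant \<open>c\<close>; a scalar acts as multiplication by its class.
\<close>

definition quotient_algebra ::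
    "('k::monoid_add \<Rightarrow>\<^sub>0 'f::field) ring \<Rightarrow> ('k \<Rightarrow>\<^sub>0 'f) set \<Rightarrow> ('f, ('k \<Rightarrow>\<^sub>0 'f) set) module" where
  "quotient_algebra P I =
     \<lparr>carrier = carrier (P Quot I), monoid.mult = monoid.mult (P Quot I),
      monoid.one = monoid.one (P Quot I), ring.zero = ring.zero (P Quot I),
      ring.add = ring.add (P Quot I),
      module.smult = (\<lambda>c x. (I +>\<^bsub>P\<^esub> Poly_Mapping.single 0 c) \<otimes>\<^bsub>P Quot I\<^esub> x)\<rparr>"

definition algebra_action ::
    "('f::field, 'a) module \<Rightarrow> ('f, 'v) module \<Rightarrow> ('a \<Rightarrow> 'v \<Rightarrow> 'v) \<Rightarrow> bool" where
  "algebra_action A V \<rho> \<longleftrightarrow>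
     (\<forall>a\<in>carrier A. \<rho> a \<in> linear_maps V V) \<and>
     (\<forall>v\<in>carrier V. \<rho> \<one>\<^bsub>A\<^esub> v = v) \<and>
     (\<forall>a\<in>carrier A. \<forall>b\<in>carrier A. \<forall>v\<in>carrier V.
        \<rho> (a \<otimes>\<^bsub>A\<^esub> b) v = \<rho> a (\<rho> b v) \<and> \<rho> (a \<oplus>\<^bsub>A\<^esub> b) v = \<rho> a v \<oplus>\<^bsub>V\<^esub> \<rho> b v) \<and>
     (\<forall>c. \<forall>a\<in>carrier A. \<forall>v\<in>carrier V. \<rho> (c \<odot>\<^bsub>A\<^esub> a) v = c \<odot>\<^bsub>V\<^esub> \<rho> a v)"


section \<open>The 0-Hecke algebra and the 0-Hecke monoid\<close>

text \<open>
  The free monoid on \<open>nat\<close>, wrapped so that it is an instance of \<^class>\<open>monoid_add\<close>: then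
  \<open>word \<Rightarrow>\<^sub>0 'f\<close> is the free algebra, with convolution as product.
\<close>

datatype word = Word "nat list"

instantiation word :: monoid_add
begin

definition zero_word :: word where "0 = Word []"

fun plus_word :: "word \<Rightarrow> word \<Rightarrow> word" where "Word u + Word v = Word (u @ v)"

instance
proof
  fix a b c :: word
  show "a + b + c = a + (b + c)" by (cases a; cases b; cases c) simp
  show "0 + a = a" "a + 0 = a" by (cases a; simp add: zero_word_def)+
qed

end

abbreviation free_gen :: "nat \<Rightarrow> word \<Rightarrow>\<^sub>0 'f::field" where
  "free_gen i \<equiv> Poly_Mapping.single (Word [i]) 1"

definition free_algebra :: "nat \<Rightarrow> (word \<Rightarrow>\<^sub>0 'f::field) ring" where
  "free_algebra n =
     \<lparr>carrier = {p. Poly_Mapping.keys p \<subseteq> Word ` lists {1..<n}},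
      monoid.mult = (*), monoid.one = 1, ring.zero = 0, ring.add = (+)\<rparr>"

definition hecke_ideal :: "nat \<Rightarrow> (word \<Rightarrow>\<^sub>0 'f::field) set" where
  "hecke_ideal n = Idl\<^bsub>free_algebra n\<^esub>
     ({free_gen i * free_gen i - free_gen i | i. i \<in> {1..<n}} \<union>
      {free_gen i * free_gen (Suc i) * free_gen i - free_gen (Suc i) * free_gen i * free_gen (Suc i)
        | i. i \<in> {1..<n} \<and> Suc i \<in> {1..<n}} \<union>
      {free_gen i * free_gen j - free_gen j * free_gen i
        | i j. i \<in> {1..<n} \<and> j \<in> {1..<n} \<and> (i + 1 < j \<or> j + 1 < i)})"

definition hecke_algebra :: "nat \<Rightarrow> ('f::field, (word \<Rightarrow>\<^sub>0 'f) set) module" where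
  "hecke_algebra n = quotient_algebra (free_algebra n) (hecke_ideal n)"

definition hecke_word :: "nat \<Rightarrow> nat list \<Rightarrow> (word \<Rightarrow>\<^sub>0 'f::field) set" where
  "hecke_word n u = hecke_ideal n +>\<^bsub>free_algebra n\<^esub> Poly_Mapping.single (Word u) 1"

abbreviation hecke_gen :: "nat \<Rightarrow> nat \<Rightarrow> (word \<Rightarrow>\<^sub>0 'f::field) set" where
  "hecke_gen n i \<equiv> hecke_word n [i]"

definition word_perm :: "nat list \<Rightarrow> nat \<Rightarrow> nat" where
  "word_perm u = foldr (\<lambda>i f. transpose i (Suc i) \<circ> f) u id"

definition reduced_expression :: "nat \<Rightarrow> (nat \<Rightarrow> nat) \<Rightarrow> nat list \<Rightarrow> bool" where
  "reduced_expression n w u \<longleftrightarrow> u \<in> lists {1..<n} \<and> word_perm u = w \<and>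
     (\<forall>v\<in>lists {1..<n}. word_perm v = w \<longrightarrow> length u \<le> length v)"

definition hecke_monoid :: "nat \<Rightarrow> (word \<Rightarrow>\<^sub>0 'f::field) set set" where
  "hecke_monoid n = {hecke_word n u | w u. w permutes {1..n} \<and> reduced_expression n w u}"

text \<open>
  The map \<open>H\<^sub>n(0) \<rightarrow> H\<^sub>m(0)\<close> for \<open>n \<le> m\<close> with \<open>\<pi>\<^sub>i \<mapsto> \<pi>\<^sub>i\<close>: the ideal for \<open>n\<close> is contained in
  the one for \<open>m\<close>, so all \<open>p \<in> x\<close> give the same coset.
\<close>

definition hecke_incl :: "nat \<Rightarrow> (word \<Rightarrow>\<^sub>0 'f::field) set \<Rightarrow> (word \<Rightarrow>\<^sub>0 'f) set" where
  "hecke_incl m x = (\<Union>p\<in>x. hecke_ideal m +>\<^bsub>free_algebra m\<^esub> p)"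


section \<open>The 0-Hecke category and its modules\<close>

definition hecke_hom_rel :: "nat \<Rightarrow> nat \<Rightarrow> (word \<Rightarrow>\<^sub>0 'f::field) set rel" where
  "hecke_hom_rel n m =
     (let r = {(x, x \<otimes>\<^bsub>hecke_algebra m\<^esub> hecke_gen m j) | x j. x \<in> hecke_monoid m \<and> j \<in> {n + 1..<m}}
      in (r \<union> r\<inverse>)\<^sup>*)"

definition hecke_class ::
    "nat \<Rightarrow> nat \<Rightarrow> (word \<Rightarrow>\<^sub>0 'f::field) set \<Rightarrow> (word \<Rightarrow>\<^sub>0 'f) set set" where
  "hecke_class n m x = hecke_hom_rel n m `` {x}"

definition hecke_hom :: "nat \<Rightarrow> nat \<Rightarrow> (word \<Rightarrow>\<^sub>0 'f::field) set set set" where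
  "hecke_hom n m = (if n \<le> m then hecke_monoid m // hecke_hom_rel n m else {})"

text \<open>\<open>hecke_comp n m l h f\<close> is the composite of \<open>f : [n] \<rightarrow> [m]\<close> with \<open>h : [m] \<rightarrow> [l]\<close>.\<close>

definition hecke_comp ::
    "nat \<Rightarrow> nat \<Rightarrow> nat \<Rightarrow> (word \<Rightarrow>\<^sub>0 'f::field) set set \<Rightarrow> (word \<Rightarrow>\<^sub>0 'f) set set \<Rightarrow>
     (word \<Rightarrow>\<^sub>0 'f) set set" where
  "hecke_comp n m l h f =
     (\<Union>y\<in>h. \<Union>x\<in>f. hecke_class n l (y \<otimes>\<^bsub>hecke_algebra l\<^esub> hecke_incl l x))"

definition hecke_iota :: "nat \<Rightarrow> nat \<Rightarrow> (word \<Rightarrow>\<^sub>0 'f::field) set set" where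
  "hecke_iota n m = hecke_class n m \<one>\<^bsub>hecke_algebra m\<^esub>"

text \<open>The identity of \<open>[n]\<close> is \<open>hecke_iota n n\<close>.\<close>

locale hecke_module =
  fixes V :: "nat \<Rightarrow> ('f::field, 'v) module"
    and act :: "nat \<Rightarrow> nat \<Rightarrow> (word \<Rightarrow>\<^sub>0 'f) set set \<Rightarrow> 'v \<Rightarrow> 'v"
  assumes vector_space: "module (ring_of_type_algebra :: 'f ring) (V n)"
    and linear: "f \<in> hecke_hom n m \<Longrightarrow> act n m f \<in> linear_maps (V n) (V m)"
    and act_id: "v \<in> carrier (V n) \<Longrightarrow> act n n (hecke_iota n n) v = v"
    and act_comp: "\<lbrakk>f \<in> hecke_hom n m; h \<in> hecke_hom m l; v \<in> carrier (V n)\<rbrakk>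
      \<Longrightarrow> act n l (hecke_comp n m l h f) v = act m l h (act n m f v)"

definition hecke_submodule ::
    "(nat \<Rightarrow> ('f::field, 'v) module) \<Rightarrow> (nat \<Rightarrow> nat \<Rightarrow> (word \<Rightarrow>\<^sub>0 'f) set set \<Rightarrow> 'v \<Rightarrow> 'v) \<Rightarrow>
     (nat \<Rightarrow> 'v set) \<Rightarrow> bool" where
  "hecke_submodule V act W \<longleftrightarrow>
     (\<forall>n. submodule (W n) (ring_of_type_algebra :: 'f ring) (V n)) \<and>
     (\<forall>n m. \<forall>f\<in>hecke_hom n m. \<forall>v\<in>W n. act n m f v \<in> W m)"

definition finitely_generated ::
    "(nat \<Rightarrow> ('f::field, 'v) module) \<Rightarrow> (nat \<Rightarrow> nat \<Rightarrow> (word \<Rightarrow>\<^sub>0 'f) set set \<Rightarrow> 'v \<Rightarrow> 'v) \<Rightarrow>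
     bool" where
  "finitely_generated V act \<longleftrightarrow>
     (\<exists>S. finite S \<and> S \<subseteq> (SIGMA n:UNIV. carrier (V n)) \<and>
       (\<forall>W. hecke_submodule V act W \<and> (\<forall>(n, v)\<in>S. v \<in> W n) \<longrightarrow> (\<forall>n. W n = carrier (V n))))"


section \<open>The Stanley-Reisner ring of the Boolean algebra\<close>

type_synonym 'f boolean_poly = "(nat set \<Rightarrow>\<^sub>0 nat) \<Rightarrow>\<^sub>0 'f"

abbreviation poly_var :: "nat set \<Rightarrow> 'f::field boolean_poly" where
  "poly_var A \<equiv> Poly_Mapping.single (Poly_Mapping.single A 1) 1"

definition poly_ring :: "nat \<Rightarrow> 'f::field boolean_poly ring" where
  "poly_ring n =
     \<lparr>carrier = {p. \<forall>m\<in>Poly_Mapping.keys p. Poly_Mapping.keys m \<subseteq> Pow {1..n}},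
      monoid.mult = (*), monoid.one = 1, ring.zero = 0, ring.add = (+)\<rparr>"

definition boolean_ideal :: "nat \<Rightarrow> 'f::field boolean_poly set" where
  "boolean_ideal n = Idl\<^bsub>poly_ring n\<^esub>
     {poly_var A * poly_var B | A B. A \<subseteq> {1..n} \<and> B \<subseteq> {1..n} \<and> \<not> A \<subseteq> B \<and> \<not> B \<subseteq> A}"

definition boolean_SR :: "nat \<Rightarrow> ('f::field, 'f boolean_poly set) module" where
  "boolean_SR n = quotient_algebra (poly_ring n) (boolean_ideal n)"

definition multichains :: "nat \<Rightarrow> nat set list set" where
  "multichains n = {M. set M \<subseteq> Pow {1..n} \<and> sorted_wrt (\<subseteq>) M}"

definition y_monomial :: "nat \<Rightarrow> nat set list \<Rightarrow> 'f::field boolean_poly set" where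
  "y_monomial n M = boolean_ideal n +>\<^bsub>poly_ring n\<^esub> prod_list (map poly_var M)"

definition chain_pos :: "nat \<Rightarrow> nat set list \<Rightarrow> nat \<Rightarrow> nat" where
  "chain_pos n M i =
     (LEAST j. j \<in> {1..length M + 1} \<and> i \<in> (M @ [{1..n}]) ! (j - 1))"

definition swap_chain :: "nat \<Rightarrow> nat set list \<Rightarrow> nat set list" where
  "swap_chain i M = map (\<lambda>A. transpose i (Suc i) ` A) M"

definition boolean_hecke_action ::
    "nat \<Rightarrow> ((word \<Rightarrow>\<^sub>0 'f::field) set \<Rightarrow> 'f boolean_poly set \<Rightarrow> 'f boolean_poly set) \<Rightarrow> bool" where
  "boolean_hecke_action n \<rho> \<longleftrightarrow>
     algebra_action (hecke_algebra n) (boolean_SR n) \<rho> \<and>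
     (\<forall>i\<in>{1..<n}. \<forall>M\<in>multichains n. \<rho> (hecke_gen n i) (y_monomial n M) =
        (if chain_pos n M i > chain_pos n M (Suc i) then \<zero>\<^bsub>boolean_SR n\<^esub>
         else if chain_pos n M i = chain_pos n M (Suc i) then y_monomial n M
         else y_monomial n (swap_chain i M) \<oplus>\<^bsub>boolean_SR n\<^esub> y_monomial n M))"

definition boolean_iota_action ::
    "nat \<Rightarrow> ('f::field boolean_poly set \<Rightarrow> 'f boolean_poly set) \<Rightarrow> bool" where
  "boolean_iota_action n J \<longleftrightarrow>
     J \<in> linear_maps (boolean_SR n) (boolean_SR (Suc n)) \<and>
     (\<forall>M\<in>multichains n. J (y_monomial n M) = y_monomial (Suc n) M)"

definition boolean_SR_graded ::
    "nat list \<Rightarrow> nat \<Rightarrow> ('f::field, 'f boolean_poly set) module" where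
  "boolean_SR_graded g n = (boolean_SR n)
     \<lparr>carrier := linear_span (boolean_SR n) {y_monomial n M | M. M \<in> multichains n \<and> map card M = g}\<rparr>"

definition restricted_boolean_action ::
    "nat list \<Rightarrow>
     (nat \<Rightarrow> nat \<Rightarrow> (word \<Rightarrow>\<^sub>0 'f::field) set set \<Rightarrow> 'f boolean_poly set \<Rightarrow> 'f boolean_poly set) \<Rightarrow>
     bool" where
  "restricted_boolean_action g act \<longleftrightarrow>
     (\<forall>n. \<exists>\<rho>. boolean_hecke_action n \<rho> \<and>
        (\<forall>x\<in>hecke_monoid n. \<forall>v\<in>carrier (boolean_SR_graded g n).
           act n n (hecke_class n n x) v = \<rho> x v)) \<and>
     (\<forall>n. \<exists>J. boolean_iota_action n J \<and>
        (\<forall>v\<in>carrier (boolean_SR_graded g n). act n (Suc n) (hecke_iota n (Suc n)) v = J v))"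

end

theory Submission
  imports Defs
begin

text \<open>
  Everything is lifted from the Stanley-Reisner ring to the polynomial ring in the variables
  \<open>y\<^sub>A\<close>, for all \<open>n\<close> at once. Whether \<open>p\<^sub>i(M) < p\<^sub>i\<^sub>+\<^sub>1(M)\<close> depends only on whether some set of
  the multichain contains \<open>i\<close> but not \<open>i + 1\<close>, and not on \<open>n\<close>. Let \<open>\<pi>\<^sub>i\<close> act by the given
  formula on monomials supported on chains and by zero on all others. These operators satisfy the
  0-Hecke relations exactly, preserve the span of the non-chain monomials (which is the
  Stanley-Reisner ideal), and \<open>\<pi>\<^sub>j\<close> with \<open>j > n\<close> fixes the monomials of multichains in \<open>[n]\<close>. So
  \<open>x \<in> \<M>\<^sub>m\<close> acts on the image of \<open>V\<^sub>n\<close> in \<open>V\<^sub>m\<close> in a way that depends only on its class in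
  \<open>Hom([n],[m])\<close>.

  Uniqueness holds because the class of \<open>x\<close> is the composite of \<open>x \<in> End([m])\<close> with
  \<open>\<iota>\<^sub>n\<^sub>,\<^sub>m\<close>. For this the set \<open>\<M>\<^sub>m\<close> of reduced words has to be closed under multiplication, which
  follows from the normal form of words as products of descending runs \<open>\<pi>\<^sub>m \<pi>\<^sub>m\<^sub>-\<^sub>1 \<dots> \<pi>\<^sub>k\<close>: such a
  product has as many letters as its permutation has inversions.

  The module is generated by \<open>y\<^sub>M\<close> for \<open>M = ([r\<^sub>1] \<subseteq> \<dots> \<subseteq> [r\<^sub>k])\<close> in degree \<open>r\<^sub>k\<close>. A multichain that is
  not of this form has some \<open>A\<close> with \<open>i + 1 \<in> A\<close> and \<open>i \<notin> A\<close>, and then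
  \<open>y\<^sub>M = (\<pi>\<^sub>i - 1) y\<^sub>M\<^sub>'\<close>, where \<open>M' = s\<^sub>i(M)\<close> has a smaller sum of elements.
\<close>

section \<open>Linear extension over finitely supported functions\<close>

lemma poly_mapping_sum_single:
  "p = (\<Sum>k\<in>Poly_Mapping.keys p. Poly_Mapping.single k (Poly_Mapping.lookup p k))"
  by (rule poly_mapping_eqI) (simp add: lookup_sum lookup_single when_def in_keys_iff)

text \<open>The carriers, the non-chain polynomials and the graded pieces are all sets of functions
  supported in some \<open>K\<close>, so facts linear in \<open>p\<close> are checked on
  \<open>single k c\<close> alone. The bound on the support is proved along with \<open>P\<close>,
  since the \<open>add\<close> case offers it for both summands.\<close>

lemma poly_mapping_keys_induct [consumes 1, case_names zero single add]:
  fixes p :: "'a \<Rightarrow>\<^sub>0 'b::comm_monoid_add"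
  assumes "Poly_Mapping.keys p \<subseteq> K"
    and "P 0"
    and "\<And>k c. k \<in> K \<Longrightarrow> P (Poly_Mapping.single k c)"
    and "\<And>p q. \<lbrakk>Poly_Mapping.keys p \<subseteq> K; Poly_Mapping.keys q \<subseteq> K; P p; P q\<rbrakk> \<Longrightarrow> P (p + q)"
  shows "P p"
proof -
  have "Poly_Mapping.keys (\<Sum>k\<in>A. Poly_Mapping.single k (f k)) \<subseteq> K \<and>
      P (\<Sum>k\<in>A. Poly_Mapping.single k (f k))" if "finite A" "A \<subseteq> K" for A f
    using that
  proof (induction A)
    case empty
    then show ?case using assms(2) by simp
  next
    case (insert x A)
    then have IH: "Poly_Mapping.keys (\<Sum>k\<in>A. Poly_Mapping.single k (f k)) \<subseteq> K"
      "P (\<Sum>k\<in>A. Poly_Mapping.single k (f k))" and x: "x \<in> K" by auto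
    have kx: "Poly_Mapping.keys (Poly_Mapping.single x (f x)) \<subseteq> K" using x by simp
    have "Poly_Mapping.keys (Poly_Mapping.single x (f x) + (\<Sum>k\<in>A. Poly_Mapping.single k (f k))) \<subseteq> K"
      using keys_add[of "Poly_Mapping.single x (f x)"] kx IH(1) by blast
    then show ?case using insert.hyps assms(4)[OF kx IH(1) assms(3)[OF x] IH(2)] by simp
  qed
  from this[OF finite_keys assms(1), of "Poly_Mapping.lookup p"] show ?thesis
    unfolding poly_mapping_sum_single[of p, symmetric] by blast
qed

lemma keys_add_subset:
  "\<lbrakk>Poly_Mapping.keys p \<subseteq> K; Poly_Mapping.keys q \<subseteq> K\<rbrakk> \<Longrightarrow> Poly_Mapping.keys (p + q) \<subseteq> K"
  using keys_add[of p q] by blast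

lemma keys_uminus: "Poly_Mapping.keys (- p) = Poly_Mapping.keys (p :: 'a \<Rightarrow>\<^sub>0 'b::ab_group_add)"
  by (auto simp: in_keys_iff)

lemma keys_diff_subset:
  fixes p q :: "'a \<Rightarrow>\<^sub>0 'b::ab_group_add"
  shows "\<lbrakk>Poly_Mapping.keys p \<subseteq> K; Poly_Mapping.keys q \<subseteq> K\<rbrakk> \<Longrightarrow> Poly_Mapping.keys (p - q) \<subseteq> K"
  using keys_add_subset[of p K "- q"] by (simp add: keys_uminus)

lemma lookup_scale:
  "Poly_Mapping.lookup (Poly_Mapping.single 0 c * p) k = c * Poly_Mapping.lookup p k"
  for p :: "'k::monoid_add \<Rightarrow>\<^sub>0 'f::field"
  by (simp add: mult_map_scale_conv_mult[symmetric] Poly_Mapping.map.rep_eq when_def)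

lemma keys_scale_subset:
  fixes p :: "'k::monoid_add \<Rightarrow>\<^sub>0 'f::field"
  shows "Poly_Mapping.keys p \<subseteq> K \<Longrightarrow> Poly_Mapping.keys (Poly_Mapping.single 0 c * p) \<subseteq> K"
  by (auto simp: in_keys_iff lookup_scale)

text \<open>Constants are central although the monoid of exponents may be that of words, which is
  not commutative; by additivity it suffices to move a constant past one monomial.\<close>

lemma scale_commute:
  fixes p q :: "'k::monoid_add \<Rightarrow>\<^sub>0 'f::field"
  shows "p * (Poly_Mapping.single 0 c * q) = Poly_Mapping.single 0 c * (p * q)"
proof -
  have "p * Poly_Mapping.single 0 c = Poly_Mapping.single 0 c * p"
  proof (induction p rule: poly_mapping_keys_induct[OF subset_UNIV, case_names zero single add])
    case (add p q)
    then show ?case by (simp add: distrib_left distrib_right)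
  qed (simp_all add: mult_single mult.commute)
  then show ?thesis by (metis mult.assoc)
qed

text \<open>Scalars appear as convolution with constants because \<open>quotient_algebra\<close>
  defines its scalar multiplication that way. Both \<open>hecke_op\<close>, extended from monomials,
  and \<open>free_op\<close>, extended from words, have this form.\<close>

definition linear_ext ::
    "('k \<Rightarrow> ('m::monoid_add \<Rightarrow>\<^sub>0 'f::field)) \<Rightarrow> ('k \<Rightarrow>\<^sub>0 'f) \<Rightarrow> ('m \<Rightarrow>\<^sub>0 'f)" where
  "linear_ext t p =
     (\<Sum>k\<in>Poly_Mapping.keys p. Poly_Mapping.single 0 (Poly_Mapping.lookup p k) * t k)"

text \<open>A common finite index set lets the sums for \<open>p\<close>, \<open>q\<close> and
  \<open>p + q\<close> be compared term by term.\<close>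

lemma linear_ext_superset:
  assumes "finite A" "Poly_Mapping.keys p \<subseteq> A"
  shows "linear_ext t p = (\<Sum>k\<in>A. Poly_Mapping.single 0 (Poly_Mapping.lookup p k) * t k)"
  unfolding linear_ext_def
  by (rule sum.mono_neutral_left) (use assms in \<open>auto simp: in_keys_iff\<close>)

lemma linear_ext_zero [simp]: "linear_ext t 0 = 0"
  by (simp add: linear_ext_def)

lemma linear_ext_single [simp]:
  "linear_ext t (Poly_Mapping.single k c) = Poly_Mapping.single 0 c * t k"
  by (subst linear_ext_superset[of "{k}"]) auto

lemma linear_ext_add: "linear_ext t (p + q) = linear_ext t p + linear_ext t q"
proof -
  let ?A = "Poly_Mapping.keys p \<union> Poly_Mapping.keys q"
  have "Poly_Mapping.keys (p + q) \<subseteq> ?A" by (rule keys_add)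
  then show ?thesis
    by (simp add: linear_ext_superset[of ?A] lookup_add single_add distrib_right sum.distrib)
qed

lemma linear_ext_scale:
  "linear_ext t (Poly_Mapping.single 0 c * p) = Poly_Mapping.single 0 c * linear_ext t p"
proof -
  have "Poly_Mapping.keys (Poly_Mapping.single 0 c * p) \<subseteq> Poly_Mapping.keys p"
    by (rule keys_scale_subset) simp
  then show ?thesis
    by (simp add: linear_ext_superset[of "Poly_Mapping.keys p"] lookup_scale sum_distrib_left
        mult.assoc[symmetric] mult_single)
qed

lemma linear_ext_uminus: "linear_ext t (- p) = - linear_ext t p"
  using linear_ext_add[of t p "- p"] by (simp add: eq_neg_iff_add_eq_0 add.commute)

lemma linear_ext_diff: "linear_ext t (p - q) = linear_ext t p - linear_ext t q"
  using linear_ext_add[of t p "- q"] by (simp add: linear_ext_uminus)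

lemma keys_linear_ext_subset:
  assumes "\<And>k. k \<in> Poly_Mapping.keys p \<Longrightarrow> Poly_Mapping.keys (t k) \<subseteq> K"
  shows "Poly_Mapping.keys (linear_ext t p) \<subseteq> K"
proof -
  have "Poly_Mapping.keys (linear_ext t p) \<subseteq>
      (\<Union>k\<in>Poly_Mapping.keys p. Poly_Mapping.keys (Poly_Mapping.single 0 (Poly_Mapping.lookup p k) * t k))"
    unfolding linear_ext_def by (rule keys_sum)
  also have "\<dots> \<subseteq> K"
    by (rule UN_least) (rule keys_scale_subset[OF assms])
  finally show ?thesis .
qed

text \<open>Linearity in the images of the basis, as opposed to linearity in \<open>p\<close>; it
  yields linearity of \<open>free_op p q\<close> in \<open>q\<close>.\<close>

lemma linear_ext_add_fun: "linear_ext (\<lambda>k. s k + t k) p = linear_ext s p + linear_ext t p"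
  by (simp add: linear_ext_def distrib_left sum.distrib)

lemma linear_ext_scale_fun:
  "linear_ext (\<lambda>k. Poly_Mapping.single 0 c * t k) p = Poly_Mapping.single 0 c * linear_ext t p"
  unfolding linear_ext_def sum_distrib_left by (rule sum.cong[OF refl]) (rule scale_commute)

section \<open>Quotients of rings of finitely supported functions\<close>

text \<open>The common form of \<open>hecke_algebra\<close> and \<open>boolean_SR\<close>. The
  record is spelled out so that ring operations reduce to those of the type class, and
  \<open>const_closed\<close> places the scalars inside the ring.\<close>

locale poly_quotient =
  fixes C I :: "('k::monoid_add \<Rightarrow>\<^sub>0 'f::field) set" and P :: "('k \<Rightarrow>\<^sub>0 'f) ring"
  assumes P_eq: "P = \<lparr>carrier = C, monoid.mult = (*), monoid.one = 1, ring.zero = 0, ring.add = (+)\<rparr>"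
    and is_ideal: "ideal I P"
    and const_closed: "Poly_Mapping.single 0 c \<in> C"
begin

abbreviation Q where "Q \<equiv> quotient_algebra P I"

definition cls where "cls p = I +>\<^bsub>P\<^esub> p"

lemma P_sel: "carrier P = C" "monoid.mult P = (*)" "\<one>\<^bsub>P\<^esub> = 1" "\<zero>\<^bsub>P\<^esub> = 0" "ring.add P = (+)"
  by (simp_all add: P_eq)

interpretation ideal I P by (rule is_ideal)

lemma
  shows C_zero: "0 \<in> C"
    and C_add: "p \<in> C \<Longrightarrow> q \<in> C \<Longrightarrow> p + q \<in> C"
    and C_mult: "p \<in> C \<Longrightarrow> q \<in> C \<Longrightarrow> p * q \<in> C"
    and C_scale: "p \<in> C \<Longrightarrow> Poly_Mapping.single 0 c * p \<in> C"
    and I_add: "p \<in> I \<Longrightarrow> q \<in> I \<Longrightarrow> p + q \<in> I"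
    and I_zero: "0 \<in> I"
  using zero_closed add.m_closed[of p q] m_closed[of p q]
    m_closed[of "Poly_Mapping.single 0 c" p] additive_subgroup.a_closed[OF is_additive_subgroup, of p q]
    additive_subgroup.zero_closed[OF is_additive_subgroup] const_closed
  by (auto simp: P_sel)

lemma I_scale: "p \<in> I \<Longrightarrow> Poly_Mapping.single 0 c * p \<in> I"
  using I_l_closed[of p "Poly_Mapping.single 0 c"] const_closed by (simp add: P_sel)

lemma C_uminus: "p \<in> C \<Longrightarrow> - p \<in> C"
  using C_scale[of p "-1"] by (simp add: single_uminus)

lemma I_uminus: "p \<in> I \<Longrightarrow> - p \<in> I"
  using I_scale[of p "-1"] by (simp add: single_uminus)

lemma cls_iff: "x \<in> cls p \<longleftrightarrow> x - p \<in> I"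
  by (auto simp: cls_def a_r_coset_def r_coset_def P_sel intro!: bexI[of _ "x - p"])

lemma cls_self: "p \<in> cls p"
  by (simp add: cls_iff I_zero)

lemma cls_eq:
  assumes "p - q \<in> I"
  shows "cls p = cls q"
proof -
  have "x - p \<in> I \<longleftrightarrow> x - q \<in> I" for x
    using I_add[of "x - p" "p - q"] I_add[of "x - q" "- (p - q)"] I_uminus[OF assms] assms by auto
  then show ?thesis by (auto simp: cls_iff)
qed

lemma cls_eqD: "cls p = cls q \<Longrightarrow> p - q \<in> I"
  using cls_self[of p] by (simp add: cls_iff)

lemma carrier_Q: "carrier Q = cls ` C"
proof -
  have "carrier Q = (\<Union>p\<in>carrier P. {cls p})"
    by (simp add: quotient_algebra_def FactRing_def A_RCOSETS_def RCOSETS_def a_r_coset_def cls_def)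
  then show ?thesis by (auto simp: P_sel)
qed

lemma Q_add: "p \<in> C \<Longrightarrow> q \<in> C \<Longrightarrow> cls p \<oplus>\<^bsub>Q\<^esub> cls q = cls (p + q)"
  using a_rcos_sum[of p q] by (simp add: quotient_algebra_def FactRing_def cls_def P_sel)

lemma Q_mult: "p \<in> C \<Longrightarrow> q \<in> C \<Longrightarrow> cls p \<otimes>\<^bsub>Q\<^esub> cls q = cls (p * q)"
  using rcoset_mult_add[of p q] by (simp add: quotient_algebra_def FactRing_def cls_def P_sel)

lemma Q_one: "\<one>\<^bsub>Q\<^esub> = cls 1"
  by (simp add: quotient_algebra_def FactRing_def cls_def P_sel)

lemma Q_zero: "\<zero>\<^bsub>Q\<^esub> = cls 0"
  using cls_iff[of _ 0] by (auto simp: quotient_algebra_def FactRing_def)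

lemma Q_smult: "p \<in> C \<Longrightarrow> c \<odot>\<^bsub>Q\<^esub> cls p = cls (Poly_Mapping.single 0 c * p)"
  using rcoset_mult_add[of "Poly_Mapping.single 0 c" p] const_closed
  by (simp add: quotient_algebra_def FactRing_def cls_def P_sel)

lemma Q_abelian_group: "abelian_group Q"
proof (rule abelian_groupI)
  fix x assume "x \<in> carrier Q"
  then obtain p where "p \<in> C" "x = cls p" by (auto simp: carrier_Q)
  then show "\<exists>y\<in>carrier Q. y \<oplus>\<^bsub>Q\<^esub> x = \<zero>\<^bsub>Q\<^esub>"
    by (auto simp: carrier_Q Q_add Q_zero C_uminus intro!: bexI[of _ "- p"])
qed (auto simp: carrier_Q Q_add Q_zero C_add C_zero ac_simps)

lemma Q_module: "module (ring_of_type_algebra :: 'f ring) Q"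
  by (rule moduleI)
    (auto simp: ring_of_type_algebra_def[where 'a='f] carrier_Q Q_add Q_smult C_scale C_add single_add mult_single
      mult.assoc[symmetric] distrib_left distrib_right Q_abelian_group
      intro: cring_from_type_algebra[unfolded ring_of_type_algebra_def])

text \<open>Closure of \<open>W\<close> is assumed operation by operation, so that the lemma also
  applies to a \<open>W\<close> known only as a submodule of a graded piece, as in the proof of
  finite generation.\<close>

lemma closed_contains_cls:
  assumes sub: "\<And>k c. k \<in> K \<Longrightarrow> Poly_Mapping.single k c \<in> C"
    and zero: "\<zero>\<^bsub>Q\<^esub> \<in> W"
    and add: "\<And>x y. x \<in> W \<Longrightarrow> y \<in> W \<Longrightarrow> x \<oplus>\<^bsub>Q\<^esub> y \<in> W"
    and smult: "\<And>c x. x \<in> W \<Longrightarrow> c \<odot>\<^bsub>Q\<^esub> x \<in> W"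
    and gen: "\<And>k. k \<in> K \<Longrightarrow> cls (Poly_Mapping.single k 1) \<in> W"
    and p: "Poly_Mapping.keys p \<subseteq> K"
  shows "cls p \<in> W"
proof -
  have "p \<in> C \<and> cls p \<in> W"
    using p
  proof (induction p rule: poly_mapping_keys_induct)
    case zero
    then show ?case using assms(2) by (simp add: Q_zero C_zero)
  next
    case (single k c)
    then show ?case
      using smult[OF gen[OF single], of c] sub[OF single] by (simp add: Q_smult mult_single)
  next
    case (add p q)
    then show ?case using assms(3)[of "cls p" "cls q"] by (simp add: Q_add C_add)
  qed
  then show ?thesis ..
qed

lemma submodule_cls:
  assumes sub: "{p. Poly_Mapping.keys p \<subseteq> K} \<subseteq> C"
  shows "submodule (cls ` {p. Poly_Mapping.keys p \<subseteq> K}) (ring_of_type_algebra :: 'f ring) Q"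
proof -
  interpret M: module "ring_of_type_algebra :: 'f ring" Q by (rule Q_module)
  have inv: "\<ominus>\<^bsub>Q\<^esub> cls p = cls (- p)" if "Poly_Mapping.keys p \<subseteq> K" for p
  proof (rule M.minus_equality)
    show "cls p \<in> carrier Q" "cls (- p) \<in> carrier Q"
      using that sub C_uminus by (auto simp: carrier_Q)
    have "p \<in> C" using that sub by blast
    then show "cls (- p) \<oplus>\<^bsub>Q\<^esub> cls p = \<zero>\<^bsub>Q\<^esub>"
      by (simp add: Q_add Q_zero C_uminus)
  qed
  have C: "p \<in> C" if "Poly_Mapping.keys p \<subseteq> K" for p using that sub by blast
  show ?thesis
  proof (rule M.submoduleI)
    show "cls ` {p. Poly_Mapping.keys p \<subseteq> K} \<subseteq> carrier Q"
      using C by (auto simp: carrier_Q)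
    show "\<zero>\<^bsub>Q\<^esub> \<in> cls ` {p. Poly_Mapping.keys p \<subseteq> K}"
      unfolding Q_zero by (rule imageI) simp
  next
    fix a b assume "a \<in> cls ` {p. Poly_Mapping.keys p \<subseteq> K}" "b \<in> cls ` {p. Poly_Mapping.keys p \<subseteq> K}"
    then obtain p q where "a = cls p" "b = cls q" "Poly_Mapping.keys p \<subseteq> K" "Poly_Mapping.keys q \<subseteq> K"
      by blast
    then show "a \<oplus>\<^bsub>Q\<^esub> b \<in> cls ` {p. Poly_Mapping.keys p \<subseteq> K}"
      by (simp add: Q_add C keys_add_subset)
  next
    fix c x assume "x \<in> cls ` {p. Poly_Mapping.keys p \<subseteq> K}"
    then obtain p where "x = cls p" "Poly_Mapping.keys p \<subseteq> K"
      by blast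
    then show "c \<odot>\<^bsub>Q\<^esub> x \<in> cls ` {p. Poly_Mapping.keys p \<subseteq> K}"
      by (simp add: Q_smult C keys_scale_subset)
  next
    fix x assume "x \<in> cls ` {p. Poly_Mapping.keys p \<subseteq> K}"
    then obtain p where "x = cls p" "Poly_Mapping.keys p \<subseteq> K"
      by blast
    then show "\<ominus>\<^bsub>Q\<^esub> x \<in> cls ` {p. Poly_Mapping.keys p \<subseteq> K}"
      by (simp add: inv keys_uminus)
  qed
qed

text \<open>The classes of polynomials supported in \<open>K\<close> form a submodule, and each of
  them lies in every submodule that contains the classes of the monomials in
  \<open>K\<close>.\<close>

lemma linear_span_cls:
  assumes sub: "{p. Poly_Mapping.keys p \<subseteq> K} \<subseteq> C"
  shows "linear_span Q ((\<lambda>k. cls (Poly_Mapping.single k 1)) ` K) = cls ` {p. Poly_Mapping.keys p \<subseteq> K}"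
    (is "?L = ?R")
proof
  show "?L \<subseteq> ?R"
    unfolding linear_span_def using submodule_cls[OF sub] by (auto intro!: Inter_lower)
  show "?R \<subseteq> ?L"
  proof -
    have "cls p \<in> W" if p: "Poly_Mapping.keys p \<subseteq> K"
      and W: "submodule W (ring_of_type_algebra :: 'f ring) Q"
      and gen: "(\<lambda>k. cls (Poly_Mapping.single k 1)) ` K \<subseteq> W" for p W
    proof (rule closed_contains_cls[OF _ _ _ _ _ p])
      interpret W: submodule W "ring_of_type_algebra :: 'f ring" Q by (rule W)
      show "\<zero>\<^bsub>Q\<^esub> \<in> W" using W.one_closed by simp
      show "x \<oplus>\<^bsub>Q\<^esub> y \<in> W" if "x \<in> W" "y \<in> W" for x y using W.m_closed that by simp
      show "c \<odot>\<^bsub>Q\<^esub> x \<in> W" if "x \<in> W" for c x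
        using W.smult_closed that by (simp add: ring_of_type_algebra_def)
    qed (use sub gen in \<open>auto simp: subset_iff\<close>)
    then show ?thesis by (auto simp: linear_span_def)
  qed
qed

end

section \<open>The operators on the polynomial ring\<close>

text \<open>For the monomial of a multichain M this is p_a(M) < p_b(M), by
  \<open>chain_pos_less_iff\<close>.\<close>

definition precedes :: "(nat set \<Rightarrow>\<^sub>0 nat) \<Rightarrow> nat \<Rightarrow> nat \<Rightarrow> bool" where
  "precedes m a b \<longleftrightarrow> (\<exists>A\<in>Poly_Mapping.keys m. a \<in> A \<and> b \<notin> A)"

definition chain_monomial :: "(nat set \<Rightarrow>\<^sub>0 nat) \<Rightarrow> bool" where
  "chain_monomial m \<longleftrightarrow> (\<forall>A\<in>Poly_Mapping.keys m. \<forall>B\<in>Poly_Mapping.keys m. A \<subseteq> B \<or> B \<subseteq> A)"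

text \<open>\<open>map_key\<close> precomposes the exponent function; as s_i is its own inverse, the
  exponent of s_i(A) in the result is the old exponent of A.\<close>

definition swap_monomial :: "nat \<Rightarrow> (nat set \<Rightarrow>\<^sub>0 nat) \<Rightarrow> (nat set \<Rightarrow>\<^sub>0 nat)" where
  "swap_monomial i = Poly_Mapping.map_key ((`) (transpose i (Suc i)))"

definition hecke_op_monomial :: "nat \<Rightarrow> (nat set \<Rightarrow>\<^sub>0 nat) \<Rightarrow> 'f::field boolean_poly" where
  "hecke_op_monomial i m =
     (if \<not> chain_monomial m \<or> precedes m (Suc i) i then 0
      else if precedes m i (Suc i) then Poly_Mapping.single (swap_monomial i m) 1 + Poly_Mapping.single m 1
      else Poly_Mapping.single m 1)"

definition hecke_op :: "nat \<Rightarrow> 'f::field boolean_poly \<Rightarrow> 'f boolean_poly" where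
  "hecke_op i = linear_ext (hecke_op_monomial i)"

lemma image_transpose_transpose [simp]: "transpose a b ` transpose a b ` A = A"
  by (simp add: image_image)

lemma inj_image_transpose: "inj ((`) (transpose a b))"
  by (rule inj_on_inverseI[where g = "(`) (transpose a b)"]) simp

lemma lookup_swap_monomial:
  "Poly_Mapping.lookup (swap_monomial i m) A = Poly_Mapping.lookup m (transpose i (Suc i) ` A)"
  by (simp add: swap_monomial_def Poly_Mapping.map_key.rep_eq inj_image_transpose)

lemma keys_swap_monomial:
  "Poly_Mapping.keys (swap_monomial i m) = (`) (transpose i (Suc i)) ` Poly_Mapping.keys m"
proof (rule Set.set_eqI)
  fix A :: "nat set"
  let ?t = "(`) (transpose i (Suc i))"
  have "A \<in> ?t ` Poly_Mapping.keys m \<longleftrightarrow> ?t A \<in> Poly_Mapping.keys m"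
    using imageI[of "?t A" "Poly_Mapping.keys m" ?t] by auto
  then show "A \<in> Poly_Mapping.keys (swap_monomial i m) \<longleftrightarrow> A \<in> ?t ` Poly_Mapping.keys m"
    by (simp add: in_keys_iff lookup_swap_monomial)
qed

lemma precedes_swap_monomial [simp]:
  "precedes (swap_monomial i m) a b \<longleftrightarrow> precedes m (transpose i (Suc i) a) (transpose i (Suc i) b)"
  by (simp add: precedes_def keys_swap_monomial in_transpose_image_iff)

lemma chain_monomial_swap [simp]: "chain_monomial (swap_monomial i m) \<longleftrightarrow> chain_monomial m"
  by (simp add: chain_monomial_def keys_swap_monomial inj_image_subset_iff)

text \<open>Witnesses for the two opposite orders would be incomparable sets.\<close>

lemma precedes_asym: "chain_monomial m \<Longrightarrow> precedes m a b \<Longrightarrow> \<not> precedes m b a"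
  unfolding precedes_def chain_monomial_def by blast

text \<open>The third point lies in the witnessing set or outside it. Together with
  \<open>precedes_asym\<close> this makes \<open>precedes m\<close> a strict weak order when
  \<open>m\<close> is a chain.\<close>

lemma precedes_cotrans: "precedes m a b \<Longrightarrow> precedes m a c \<or> precedes m c b"
  unfolding precedes_def by blast

lemma swap_monomial_commute:
  assumes "Suc i < j"
  shows "swap_monomial i (swap_monomial j m) = swap_monomial j (swap_monomial i m)"
proof -
  have "transpose j (Suc j) (transpose i (Suc i) x) = transpose i (Suc i) (transpose j (Suc j) x)" for x
    using assms by (auto simp: transpose_def)
  then show ?thesis
    by (intro poly_mapping_eqI) (simp add: lookup_swap_monomial image_image)
qed

lemma swap_monomial_braid:
  "swap_monomial i (swap_monomial (Suc i) (swap_monomial i m)) =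
   swap_monomial (Suc i) (swap_monomial i (swap_monomial (Suc i) m))"
proof -
  have "transpose i (Suc i) (transpose (Suc i) (Suc (Suc i)) (transpose i (Suc i) x)) =
      transpose (Suc i) (Suc (Suc i)) (transpose i (Suc i) (transpose (Suc i) (Suc (Suc i)) x))" for x
    by (auto simp: transpose_def)
  then show ?thesis
    by (intro poly_mapping_eqI) (simp add: lookup_swap_monomial image_image)
qed

lemma hecke_op_zero [simp]: "hecke_op i 0 = 0"
  by (simp add: hecke_op_def)

lemma hecke_op_add: "hecke_op i (p + q) = hecke_op i p + hecke_op i q"
  by (simp add: hecke_op_def linear_ext_add)

lemma hecke_op_scale: "hecke_op i (Poly_Mapping.single 0 c * p) = Poly_Mapping.single 0 c * hecke_op i p"
  by (simp add: hecke_op_def linear_ext_scale)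

lemma hecke_op_single:
  "hecke_op i (Poly_Mapping.single m c) =
     (if \<not> chain_monomial m \<or> precedes m (Suc i) i then 0
      else if precedes m i (Suc i) then Poly_Mapping.single (swap_monomial i m) c + Poly_Mapping.single m c
      else Poly_Mapping.single m c)"
  by (simp add: hecke_op_def hecke_op_monomial_def mult_single distrib_left)

text \<open>If i precedes i + 1 in m, the opposite holds in s_i(m); so the operator kills s_i(m) and
  sends s_i(m) + m to itself.\<close>

lemma hecke_op_idem: "hecke_op i (hecke_op i p) = hecke_op i p"
proof (induction p rule: poly_mapping_keys_induct[OF subset_UNIV, case_names zero single add])
  case (single m c)
  then show ?case by (auto simp: hecke_op_single hecke_op_add dest: precedes_asym)
qed (simp_all add: hecke_op_add)

text \<open>Each of s_i and s_j fixes the two indices that the other operator compares, so neither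
  affects the case distinction of the other.\<close>

lemma hecke_op_commute:
  assumes "Suc i < j"
  shows "hecke_op i (hecke_op j p) = hecke_op j (hecke_op i p)"
proof (induction p rule: poly_mapping_keys_induct[OF subset_UNIV, case_names zero single add])
  case (single m c)
  have [simp]: "transpose j (Suc j) i = i" "transpose j (Suc j) (Suc i) = Suc i"
    "transpose i (Suc i) j = j" "transpose i (Suc i) (Suc j) = Suc j"
    using assms by (auto simp: transpose_def)
  show ?case
    by (simp add: hecke_op_single hecke_op_add swap_monomial_commute[OF assms] ac_simps)
qed (simp_all add: hecke_op_add)

lemma hecke_op_braid:
  "hecke_op i (hecke_op (Suc i) (hecke_op i p)) = hecke_op (Suc i) (hecke_op i (hecke_op (Suc i) p))"
proof (induction p rule: poly_mapping_keys_induct[OF subset_UNIV, case_names zero single add])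
  case (single m c)
  let ?a = i and ?b = "Suc i" and ?c = "Suc (Suc i)"
  have [simp]: "transpose i (Suc i) ?c = ?c" "transpose (Suc i) (Suc (Suc i)) i = i"
    by (auto simp: transpose_def)
  show ?case
  proof (cases "chain_monomial m")
    case True
    \<comment> \<open>Of the 64 patterns of comparisons, \<open>as\<close> and \<open>co\<close>
      leave only the 13 weak orders of i, i + 1, i + 2; for each of them both sides expand to the
      same sum of monomials.\<close>
    note as = precedes_asym[OF True, of ?a ?b] precedes_asym[OF True, of ?a ?c] precedes_asym[OF True, of ?b ?c]
    note co = precedes_cotrans[of m ?a ?b ?c] precedes_cotrans[of m ?a ?c ?b] precedes_cotrans[of m ?b ?a ?c]
      precedes_cotrans[of m ?b ?c ?a] precedes_cotrans[of m ?c ?a ?b] precedes_cotrans[of m ?c ?b ?a]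
    show ?thesis
      using as co True
      by (cases "precedes m ?a ?b"; cases "precedes m ?b ?a"; cases "precedes m ?b ?c"; cases "precedes m ?c ?b";
          cases "precedes m ?a ?c"; cases "precedes m ?c ?a")
        (simp_all add: hecke_op_single hecke_op_add swap_monomial_braid ac_simps)
  qed (simp add: hecke_op_single)
qed (simp_all add: hecke_op_add)

lemma keys_hecke_op_subset:
  assumes "Poly_Mapping.keys p \<subseteq> K"
    and "\<And>m. m \<in> K \<Longrightarrow> chain_monomial m \<Longrightarrow> swap_monomial i m \<in> K"
  shows "Poly_Mapping.keys (hecke_op i p) \<subseteq> K"
  unfolding hecke_op_def
proof (rule keys_linear_ext_subset)
  fix m assume "m \<in> Poly_Mapping.keys p"
  then have "m \<in> K" using assms(1) by blast
  then show "Poly_Mapping.keys (hecke_op_monomial i m) \<subseteq> K"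
    using assms(2)[of m] by (simp add: hecke_op_monomial_def keys_add_subset)
qed

section \<open>The action of words and of the free algebra on polynomials\<close>

primrec word_op :: "word \<Rightarrow> 'f::field boolean_poly \<Rightarrow> 'f boolean_poly" where
  "word_op (Word u) q = foldr hecke_op u q"

lemma word_op_plus: "word_op (u + v) q = word_op u (word_op v q)"
  by (cases u; cases v) simp

lemma word_op_zero_word [simp]: "word_op 0 q = q"
  by (simp add: zero_word_def)

lemma word_op_add: "word_op w (p + q) = word_op w p + word_op w q"
proof (cases w)
  case (Word u)
  have "foldr hecke_op u (p + q) = foldr hecke_op u p + foldr hecke_op u q"
    by (induction u) (simp_all add: hecke_op_add)
  then show ?thesis by (simp add: Word)
qed

lemma word_op_scale:
  "word_op w (Poly_Mapping.single 0 c * q) = Poly_Mapping.single 0 c * word_op w q"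
proof (cases w)
  case (Word u)
  have "foldr hecke_op u (Poly_Mapping.single 0 c * q) = Poly_Mapping.single 0 c * foldr hecke_op u q"
    by (induction u) (simp_all add: hecke_op_scale)
  then show ?thesis by (simp add: Word)
qed

definition free_op :: "(word \<Rightarrow>\<^sub>0 'f::field) \<Rightarrow> 'f boolean_poly \<Rightarrow> 'f boolean_poly" where
  "free_op p q = linear_ext (\<lambda>w. word_op w q) p"

lemma free_op_single: "free_op (Poly_Mapping.single w c) q = Poly_Mapping.single 0 c * word_op w q"
  by (simp add: free_op_def)

lemma free_op_zero [simp]: "free_op 0 q = 0"
  by (simp add: free_op_def)

lemma free_op_one [simp]: "free_op 1 q = q"
  using free_op_single[of 0 1 q] by simp

lemma free_op_add: "free_op (p + p') q = free_op p q + free_op p' q"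
  by (simp add: free_op_def linear_ext_add)

lemma free_op_diff: "free_op (p - p') q = free_op p q - free_op p' q"
  by (simp add: free_op_def linear_ext_diff)

lemma free_op_scale: "free_op (Poly_Mapping.single 0 c * p) q = Poly_Mapping.single 0 c * free_op p q"
  by (simp add: free_op_def linear_ext_scale)

lemma free_op_add_right: "free_op p (q + q') = free_op p q + free_op p q'"
  by (simp add: free_op_def word_op_add linear_ext_add_fun)

lemma free_op_scale_right:
  "free_op p (Poly_Mapping.single 0 c * q) = Poly_Mapping.single 0 c * free_op p q"
  by (simp add: free_op_def word_op_scale linear_ext_scale_fun)

lemma free_op_zero_right [simp]: "free_op p 0 = 0"
  using free_op_scale_right[of p 0 0] by simp

text \<open>Both sides are additive in either factor, so two single words suffice, and there
  concatenation is composition with the right word acting first.\<close>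

lemma free_op_mult: "free_op (p * p') q = free_op p (free_op p' q)"
proof (induction p rule: poly_mapping_keys_induct[OF subset_UNIV, case_names zero single add])
  case (single w c)
  show ?case
  proof (induction p' rule: poly_mapping_keys_induct[OF subset_UNIV, case_names zero single add])
    case (single w' c')
    show ?case
      by (simp add: free_op_single mult_single word_op_plus word_op_scale mult.assoc[symmetric])
  qed (simp_all add: distrib_left free_op_add free_op_add_right)
qed (simp_all add: distrib_right free_op_add)

lemma free_op_gen [simp]: "free_op (free_gen i) q = hecke_op i q"
  by (simp add: free_op_single)

lemma keys_free_op_subset:
  assumes p: "p \<in> carrier (free_algebra n)"
    and q: "Poly_Mapping.keys q \<subseteq> K"
    and K: "\<And>i m. \<lbrakk>i \<in> {1..<n}; m \<in> K; chain_monomial m\<rbrakk> \<Longrightarrow> swap_monomial i m \<in> K"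
  shows "Poly_Mapping.keys (free_op p q) \<subseteq> K"
  unfolding free_op_def
proof (rule keys_linear_ext_subset)
  fix w assume "w \<in> Poly_Mapping.keys p"
  then obtain u where w: "w = Word u" and u: "u \<in> lists {1..<n}"
    using p by (auto simp: free_algebra_def)
  have "Poly_Mapping.keys (foldr hecke_op u q) \<subseteq> K"
    using u
  proof induction
    case (Cons i u)
    show ?case
      using keys_hecke_op_subset[OF Cons.IH K[OF Cons.hyps(1)]] by simp
  qed (simp add: q)
  then show "Poly_Mapping.keys (word_op w q) \<subseteq> K" by (simp add: w)
qed

section \<open>The two quotient algebras\<close>

lemma ring_of_carrier:
  fixes C :: "'a::ring_1 set"
  assumes "1 \<in> C" "\<And>x y. x \<in> C \<Longrightarrow> y \<in> C \<Longrightarrow> x + y \<in> C"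
    "\<And>x y. x \<in> C \<Longrightarrow> y \<in> C \<Longrightarrow> x * y \<in> C" "\<And>x. x \<in> C \<Longrightarrow> - x \<in> C"
  shows "ring \<lparr>carrier = C, monoid.mult = (*), monoid.one = 1, ring.zero = 0, ring.add = (+)\<rparr>"
proof -
  have 0: "0 \<in> C" using assms(2)[of 1 "- 1"] assms(1,4) by simp
  show ?thesis
  proof (rule ringI)
    show "abelian_group \<lparr>carrier = C, monoid.mult = (*), monoid.one = 1, ring.zero = 0, ring.add = (+)\<rparr>"
    proof (rule abelian_groupI)
      fix x assume "x \<in> carrier \<lparr>carrier = C, monoid.mult = (*), monoid.one = 1, ring.zero = 0, ring.add = (+)\<rparr>"
      then show "\<exists>y\<in>carrier \<lparr>carrier = C, monoid.mult = (*), monoid.one = 1, ring.zero = 0, ring.add = (+)\<rparr>.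
          y \<oplus>\<^bsub>\<lparr>carrier = C, monoid.mult = (*), monoid.one = 1, ring.zero = 0, ring.add = (+)\<rparr>\<^esub> x =
          \<zero>\<^bsub>\<lparr>carrier = C, monoid.mult = (*), monoid.one = 1, ring.zero = 0, ring.add = (+)\<rparr>\<^esub>"
        using assms(4) by (intro bexI[of _ "- x"]) auto
    qed (use assms 0 in \<open>auto simp: ac_simps\<close>)
    show "Group.monoid \<lparr>carrier = C, monoid.mult = (*), monoid.one = 1, ring.zero = 0, ring.add = (+)\<rparr>"
      by (rule monoidI) (use assms in \<open>auto simp: mult.assoc\<close>)
  qed (auto simp: algebra_simps)
qed

lemma ideal_of_carrier:
  fixes C :: "'a::ring_1 set"
  defines "P \<equiv> \<lparr>carrier = C, monoid.mult = (*), monoid.one = 1, ring.zero = 0, ring.add = (+)\<rparr>"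
  assumes ring: "ring P"
    and "I \<subseteq> C" "0 \<in> I" "\<And>x y. x \<in> I \<Longrightarrow> y \<in> I \<Longrightarrow> x + y \<in> I"
    and "\<And>x y. x \<in> I \<Longrightarrow> y \<in> C \<Longrightarrow> y * x \<in> I \<and> x * y \<in> I"
    and "\<And>x. x \<in> C \<Longrightarrow> - x \<in> C"
  shows "ideal I P"
proof (rule idealI[OF ring])
  interpret ring P by (rule ring)
  have minus: "\<ominus>\<^bsub>P\<^esub> x = - x" if "x \<in> C" for x
    by (rule minus_equality) (use that assms(7) in \<open>auto simp: P_def\<close>)
  \<comment> \<open>The additive inverse of x is (-1) x, and -1 lies in \<open>C\<close>, so
    absorption under multiplication supplies it.\<close>
  have inv: "inv\<^bsub>add_monoid P\<^esub> x \<in> I" if "x \<in> I" for x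
    using assms(6)[OF that, of "-1"] assms(7)[of 1] one_closed minus[of x] assms(3) that
    by (auto simp: P_def a_inv_def)
  show "subgroup I (add_monoid P)"
    by (rule group.subgroupI[OF a_group _ _ inv]) (use assms(3-5) in \<open>auto simp: P_def\<close>)
qed (use assms(6) in \<open>auto simp: P_def\<close>)

section \<open>The 0-Hecke algebra as a quotient of the free algebra\<close>

definition free_carrier :: "nat \<Rightarrow> (word \<Rightarrow>\<^sub>0 'f::field) set" where
  "free_carrier n = {p. Poly_Mapping.keys p \<subseteq> Word ` lists {1..<n}}"

lemma free_algebra_eq:
  "free_algebra n = \<lparr>carrier = free_carrier n, monoid.mult = (*), monoid.one = 1, ring.zero = 0, ring.add = (+)\<rparr>"
  by (simp add: free_algebra_def free_carrier_def)

lemma carrier_free_algebra: "carrier (free_algebra n) = free_carrier n"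
  by (simp add: free_algebra_eq)

lemma free_carrier_mono: "n \<le> m \<Longrightarrow> free_carrier n \<subseteq> free_carrier m"
  unfolding free_carrier_def
  by (intro Collect_mono impI, erule subset_trans, intro image_mono lists_mono) auto

lemma
  shows free_carrier_one: "1 \<in> free_carrier n"
    and free_carrier_add: "p \<in> free_carrier n \<Longrightarrow> q \<in> free_carrier n \<Longrightarrow> p + q \<in> free_carrier n"
    and free_carrier_uminus: "p \<in> free_carrier n \<Longrightarrow> - p \<in> free_carrier n"
    and free_carrier_single: "u \<in> lists {1..<n} \<Longrightarrow> Poly_Mapping.single (Word u) c \<in> free_carrier n"
  by (auto simp: free_carrier_def keys_uminus zero_word_def keys_add_subset[THEN subsetD])

lemma free_carrier_const: "Poly_Mapping.single 0 c \<in> free_carrier n"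
  using free_carrier_single[of "[]" n c] by (simp add: zero_word_def)

lemma free_carrier_mult:
  assumes "p \<in> free_carrier n" "q \<in> free_carrier n"
  shows "p * q \<in> free_carrier n"
proof -
  have "w + v \<in> Word ` lists {1..<n}" if "w \<in> Poly_Mapping.keys p" "v \<in> Poly_Mapping.keys q" for w v
  proof -
    from that assms obtain a b where "w = Word a" "v = Word b" "a \<in> lists {1..<n}" "b \<in> lists {1..<n}"
      unfolding free_carrier_def by blast
    then show ?thesis by auto
  qed
  then show ?thesis
    using keys_mult[of p q] unfolding free_carrier_def by blast
qed

lemma free_algebra_ring: "ring (free_algebra n)"
  unfolding free_algebra_eq
  by (intro ring_of_carrier free_carrier_one free_carrier_add free_carrier_uminus free_carrier_mult)

definition hecke_relations :: "nat \<Rightarrow> (word \<Rightarrow>\<^sub>0 'f::field) set" where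
  "hecke_relations n =
     {free_gen i * free_gen i - free_gen i | i. i \<in> {1..<n}} \<union>
      {free_gen i * free_gen (Suc i) * free_gen i - free_gen (Suc i) * free_gen i * free_gen (Suc i)
        | i. i \<in> {1..<n} \<and> Suc i \<in> {1..<n}} \<union>
      {free_gen i * free_gen j - free_gen j * free_gen i
        | i j. i \<in> {1..<n} \<and> j \<in> {1..<n} \<and> (i + 1 < j \<or> j + 1 < i)}"

lemma hecke_ideal_eq: "hecke_ideal n = Idl\<^bsub>free_algebra n\<^esub> (hecke_relations n)"
  by (simp add: hecke_ideal_def hecke_relations_def)

lemma hecke_relations_subset: "hecke_relations n \<subseteq> free_carrier n"
proof -
  have diff: "p - q \<in> free_carrier n" if "p \<in> free_carrier n" "q \<in> free_carrier n" for p q :: "word \<Rightarrow>\<^sub>0 'a"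
    using free_carrier_add[OF that(1) free_carrier_uminus[OF that(2)]] by simp
  show ?thesis
    unfolding hecke_relations_def
    by (auto intro!: diff free_carrier_mult free_carrier_single)
qed

lemma hecke_ideal_ideal: "ideal (hecke_ideal n) (free_algebra n)"
  unfolding hecke_ideal_eq
  by (rule ring.genideal_ideal[OF free_algebra_ring])
    (use hecke_relations_subset in \<open>simp add: free_algebra_eq\<close>)

lemma hecke_relations_in_ideal: "hecke_relations n \<subseteq> hecke_ideal n"
  unfolding hecke_ideal_eq
  by (rule ring.genideal_self[OF free_algebra_ring])
    (use hecke_relations_subset in \<open>simp add: free_algebra_eq\<close>)

interpretation hecke: poly_quotient "free_carrier n" "hecke_ideal n" "free_algebra n" for n
  by (rule poly_quotient.intro[OF free_algebra_eq hecke_ideal_ideal free_carrier_const])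

section \<open>The Stanley-Reisner ideal as the span of the non-chain monomials\<close>

definition poly_monomials :: "nat \<Rightarrow> (nat set \<Rightarrow>\<^sub>0 nat) set" where
  "poly_monomials n = {m. Poly_Mapping.keys m \<subseteq> Pow {1..n}}"

definition poly_carrier :: "nat \<Rightarrow> 'f::field boolean_poly set" where
  "poly_carrier n = {p. Poly_Mapping.keys p \<subseteq> poly_monomials n}"

lemma poly_ring_eq:
  "poly_ring n = \<lparr>carrier = poly_carrier n, monoid.mult = (*), monoid.one = 1, ring.zero = 0, ring.add = (+)\<rparr>"
  by (auto simp: poly_ring_def poly_carrier_def poly_monomials_def)

lemma keys_add_nat: "Poly_Mapping.keys (a + b) = Poly_Mapping.keys a \<union> Poly_Mapping.keys (b :: 'a \<Rightarrow>\<^sub>0 nat)"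
  by (auto simp: in_keys_iff lookup_add)

lemma poly_monomials_mono: "n \<le> m \<Longrightarrow> poly_monomials n \<subseteq> poly_monomials m"
  by (force simp: poly_monomials_def)

lemma poly_monomials_add:
  "a + b \<in> poly_monomials n \<longleftrightarrow> a \<in> poly_monomials n \<and> b \<in> poly_monomials n"
  by (simp add: poly_monomials_def keys_add_nat)

lemma poly_carrier_const: "Poly_Mapping.single 0 c \<in> poly_carrier n"
  by (simp add: poly_carrier_def poly_monomials_def)

lemma poly_carrier_add: "p \<in> poly_carrier n \<Longrightarrow> q \<in> poly_carrier n \<Longrightarrow> p + q \<in> poly_carrier n"
  by (simp add: poly_carrier_def keys_add_subset)

lemma poly_carrier_uminus: "p \<in> poly_carrier n \<Longrightarrow> - p \<in> poly_carrier n"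
  by (simp add: poly_carrier_def keys_uminus)

lemma poly_carrier_mult:
  assumes "p \<in> poly_carrier n" "q \<in> poly_carrier n"
  shows "p * q \<in> poly_carrier n"
proof -
  have "a + b \<in> poly_monomials n" if "a \<in> Poly_Mapping.keys p" "b \<in> Poly_Mapping.keys q" for a b
    using that assms by (auto simp: poly_carrier_def poly_monomials_add)
  then show ?thesis
    using keys_mult[of p q] unfolding poly_carrier_def by blast
qed

lemma poly_ring_ring: "ring (poly_ring n)"
  unfolding poly_ring_eq
  by (intro ring_of_carrier poly_carrier_add poly_carrier_uminus poly_carrier_mult)
    (use poly_carrier_const[of 1] in simp)

definition nonchain_ideal :: "nat \<Rightarrow> 'f::field boolean_poly set" where
  "nonchain_ideal n = {p. Poly_Mapping.keys p \<subseteq> {m \<in> poly_monomials n. \<not> chain_monomial m}}"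

text \<open>Read contrapositively, a multiple of a non-chain monomial is again non-chain, which is
  the ideal property of their span.\<close>

lemma chain_monomial_addD: "chain_monomial (a + b) \<Longrightarrow> chain_monomial a \<and> chain_monomial b"
  by (auto simp: chain_monomial_def keys_add_nat)

lemma nonchain_ideal_ideal: "ideal (nonchain_ideal n :: 'f::field boolean_poly set) (poly_ring n)"
  unfolding poly_ring_eq
proof (rule ideal_of_carrier[OF poly_ring_ring[unfolded poly_ring_eq]])
  fix p q :: "'f boolean_poly"
  assume p: "p \<in> nonchain_ideal n" and q: "q \<in> poly_carrier n"
  have "a + b \<in> {m \<in> poly_monomials n. \<not> chain_monomial m}"
    if "a \<in> Poly_Mapping.keys p" "b \<in> Poly_Mapping.keys q" for a b
    using that p q chain_monomial_addD[of a b]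
    by (auto simp: nonchain_ideal_def poly_carrier_def poly_monomials_add)
  then have "p * q \<in> nonchain_ideal n"
    using keys_mult[of p q] unfolding nonchain_ideal_def by blast
  then show "q * p \<in> nonchain_ideal n \<and> p * q \<in> nonchain_ideal n"
    by (simp add: mult.commute)
qed (auto simp: nonchain_ideal_def poly_carrier_def keys_uminus keys_add_subset)

text \<open>The generators are non-chain monomials, and every non-chain monomial is a multiple of
  one of them.\<close>

lemma boolean_ideal_eq: "boolean_ideal n = (nonchain_ideal n :: 'f::field boolean_poly set)"
proof
  let ?R = "poly_ring n :: 'f boolean_poly ring"
  interpret ring ?R by (rule poly_ring_ring)
  let ?S = "{poly_var A * poly_var B | A B. A \<subseteq> {1..n} \<and> B \<subseteq> {1..n} \<and> \<not> A \<subseteq> B \<and> \<not> B \<subseteq> A}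
      :: 'f boolean_poly set"
  have S: "?S \<subseteq> nonchain_ideal n"
  proof
    fix x assume "x \<in> ?S"
    then obtain A B where "x = poly_var A * poly_var B" "A \<subseteq> {1..n}" "B \<subseteq> {1..n}" "\<not> A \<subseteq> B" "\<not> B \<subseteq> A"
      by blast
    then show "x \<in> nonchain_ideal n"
      by (simp add: nonchain_ideal_def mult_single poly_monomials_def chain_monomial_def keys_add_nat)
  qed
  then show "boolean_ideal n \<subseteq> (nonchain_ideal n :: 'f boolean_poly set)"
    unfolding boolean_ideal_def by (rule genideal_minimal[OF nonchain_ideal_ideal])
  have SC: "?S \<subseteq> carrier ?R"
    using S by (auto simp: nonchain_ideal_def poly_ring_eq poly_carrier_def)
  interpret ideal "boolean_ideal n" ?R
    unfolding boolean_ideal_def by (rule genideal_ideal[OF SC])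
  have gen: "Poly_Mapping.single m c \<in> boolean_ideal n"
    if m: "m \<in> poly_monomials n" "\<not> chain_monomial m" for m and c :: 'f
  proof -
    obtain A B where AB: "A \<in> Poly_Mapping.keys m" "B \<in> Poly_Mapping.keys m" "\<not> A \<subseteq> B" "\<not> B \<subseteq> A"
      using m(2) by (auto simp: chain_monomial_def)
    \<comment> \<open>The cofactor of y_A y_B in the monomial. A and B are distinct and both have a
      positive exponent, so the truncated subtraction loses nothing.\<close>
    define r where "r = m - Poly_Mapping.single A 1 - Poly_Mapping.single B 1"
    have "A \<noteq> B" using AB by auto
    then have m_eq: "m = r + (Poly_Mapping.single A 1 + Poly_Mapping.single B 1)"
      using AB(1,2) unfolding r_def
      by (intro poly_mapping_eqI) (auto simp: lookup_add lookup_minus lookup_single when_def in_keys_iff)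
    have rm: "r \<in> poly_monomials n" using m(1) m_eq by (metis poly_monomials_add)
    have "poly_var A * poly_var B \<in> (boolean_ideal n :: 'f boolean_poly set)"
      unfolding boolean_ideal_def
    proof (rule genideal_self[OF SC, THEN subsetD])
      have "A \<subseteq> {1..n}" "B \<subseteq> {1..n}" using m(1) AB unfolding poly_monomials_def by blast+
      then show "poly_var A * poly_var B \<in> ?S" using AB(3,4) by blast
    qed
    from I_l_closed[OF this, of "Poly_Mapping.single r c"] rm
    have "Poly_Mapping.single r c * (poly_var A * poly_var B) \<in> boolean_ideal n"
      by (simp add: poly_ring_eq poly_carrier_def)
    then show ?thesis by (subst m_eq) (simp add: mult_single)
  qed
  have closed: "p + q \<in> boolean_ideal n"
    if "p \<in> boolean_ideal n" "q \<in> boolean_ideal n" for p q :: "'f boolean_poly"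
    using additive_subgroup.a_closed[OF is_additive_subgroup that] by (simp add: poly_ring_eq)
  show "nonchain_ideal n \<subseteq> (boolean_ideal n :: 'f boolean_poly set)"
  proof
    fix p :: "'f boolean_poly" assume "p \<in> nonchain_ideal n"
    then have "Poly_Mapping.keys p \<subseteq> {m \<in> poly_monomials n. \<not> chain_monomial m}"
      by (simp add: nonchain_ideal_def)
    then show "p \<in> boolean_ideal n"
    proof (induction p rule: poly_mapping_keys_induct)
      case zero
      show ?case using additive_subgroup.zero_closed[OF is_additive_subgroup] by (simp add: poly_ring_eq)
    qed (simp_all add: gen closed)
  qed
qed

interpretation SR: poly_quotient "poly_carrier n" "boolean_ideal n" "poly_ring n" for n
  by (rule poly_quotient.intro[OF poly_ring_eq nonchain_ideal_ideal[folded boolean_ideal_eq] poly_carrier_const])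

section \<open>The action of cosets and the inclusions\<close>

lemma hecke_algebra_eq: "hecke_algebra n = hecke.Q n"
  by (rule hecke_algebra_def)

lemma hecke_word_eq: "hecke_word n u = hecke.cls n (Poly_Mapping.single (Word u) 1)"
  by (simp add: hecke_word_def hecke.cls_def)

lemma hecke_op_commute_far:
  "Suc i < j \<or> Suc j < i \<Longrightarrow> hecke_op i (hecke_op j p) = hecke_op j (hecke_op i p)"
  using hecke_op_commute[of i j p] hecke_op_commute[of j i p] by auto

lemma free_op_hecke_relations:
  assumes "p \<in> hecke_relations n"
  shows "free_op p q = 0"
  using assms unfolding hecke_relations_def
  by (auto simp: free_op_diff free_op_mult hecke_op_idem hecke_op_braid intro: hecke_op_commute_far)

text \<open>The elements that annihilate every polynomial form a two-sided ideal containing the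
  relations. Having all \<open>q\<close> inside the set \<open>?I\<close> is what gives closure
  under multiplication on the right.\<close>

lemma free_op_hecke_ideal:
  assumes "p \<in> hecke_ideal n"
  shows "free_op p q = 0"
proof -
  let ?I = "{p \<in> free_carrier n. \<forall>q. free_op p q = 0}"
  have "ideal ?I (free_algebra n)"
    unfolding free_algebra_eq
    by (rule ideal_of_carrier[OF free_algebra_ring[unfolded free_algebra_eq]])
      (auto simp: free_op_add free_op_mult hecke.C_zero free_carrier_add free_carrier_mult free_carrier_uminus)
  moreover have "hecke_relations n \<subseteq> ?I"
    using hecke_relations_subset free_op_hecke_relations by blast
  ultimately have "hecke_ideal n \<subseteq> ?I"
    unfolding hecke_ideal_eq by (rule ring.genideal_minimal[OF free_algebra_ring])
  then show ?thesis using assms by blast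
qed

text \<open>Any representative gives the same operator by \<open>free_op_hecke_ideal\<close>. There
  is no index n, so an element and its image under \<open>hecke_incl\<close> act by literally the
  same rule.\<close>

definition coset_op :: "(word \<Rightarrow>\<^sub>0 'f::field) set \<Rightarrow> 'f boolean_poly \<Rightarrow> 'f boolean_poly" where
  "coset_op x q = free_op (SOME p. p \<in> x) q"

lemma coset_op_cls [simp]: "coset_op (hecke.cls n p) q = free_op p q"
proof -
  have "(SOME p'. p' \<in> hecke.cls n p) \<in> hecke.cls n p"
    by (rule someI[of _ p]) (rule hecke.cls_self)
  then have "free_op ((SOME p'. p' \<in> hecke.cls n p) - p) q = 0"
    by (intro free_op_hecke_ideal[of _ n]) (simp add: hecke.cls_iff)
  then show ?thesis by (simp add: coset_op_def free_op_diff)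
qed

lemma coset_op_word [simp]: "coset_op (hecke_word n u) q = foldr hecke_op u q"
  by (simp add: hecke_word_eq free_op_single)

lemma coset_op_mult:
  assumes "x \<in> carrier (hecke_algebra n)" "y \<in> carrier (hecke_algebra n)"
  shows "coset_op (x \<otimes>\<^bsub>hecke_algebra n\<^esub> y) q = coset_op x (coset_op y q)"
  using assms by (auto simp: hecke_algebra_eq hecke.carrier_Q hecke.Q_mult free_op_mult)

lemma coset_op_add_right: "coset_op x (p + q) = coset_op x p + coset_op x q"
  by (simp add: coset_op_def free_op_add_right)

lemma coset_op_scale_right:
  "coset_op x (Poly_Mapping.single 0 c * q) = Poly_Mapping.single 0 c * coset_op x q"
  by (simp add: coset_op_def free_op_scale_right)

lemma keys_coset_op_subset:
  assumes "x \<in> carrier (hecke_algebra n)" "Poly_Mapping.keys q \<subseteq> K"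
    and "\<And>i m. \<lbrakk>i \<in> {1..<n}; m \<in> K; chain_monomial m\<rbrakk> \<Longrightarrow> swap_monomial i m \<in> K"
  shows "Poly_Mapping.keys (coset_op x q) \<subseteq> K"
proof -
  from assms(1) obtain p where p: "p \<in> carrier (free_algebra n)" "x = hecke.cls n p"
    by (auto simp: hecke_algebra_eq hecke.carrier_Q carrier_free_algebra)
  show ?thesis using keys_free_op_subset[OF p(1) assms(2,3)] p(2) by simp
qed

text \<open>The ideal for m, cut down to the smaller free algebra, is an ideal there and contains
  the relations for n; the ideal generated by these is the least such.\<close>

lemma hecke_ideal_mono:
  assumes "n \<le> m"
  shows "hecke_ideal n \<subseteq> (hecke_ideal m :: (word \<Rightarrow>\<^sub>0 'f::field) set)"
proof -
  let ?I = "hecke_ideal m \<inter> free_carrier n :: (word \<Rightarrow>\<^sub>0 'f) set"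
  have "ideal ?I (free_algebra n)"
    unfolding free_algebra_eq
  proof (rule ideal_of_carrier[OF free_algebra_ring[unfolded free_algebra_eq]])
    fix x y :: "word \<Rightarrow>\<^sub>0 'f"
    assume x: "x \<in> ?I" and y: "y \<in> free_carrier n"
    interpret ideal "hecke_ideal m" "free_algebra m :: (word \<Rightarrow>\<^sub>0 'f) ring" by (rule hecke_ideal_ideal)
    have "y \<in> free_carrier m" using y free_carrier_mono[OF assms] by blast
    then show "y * x \<in> ?I \<and> x * y \<in> ?I"
      using I_l_closed[of x y] I_r_closed[of x y] x y by (simp add: free_algebra_eq free_carrier_mult)
  qed (auto simp: hecke.I_zero hecke.C_zero hecke.I_add free_carrier_add free_carrier_uminus)
  moreover have "{1..<n} \<subseteq> {1..<m}" using assms by auto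
  then have "hecke_relations n \<subseteq> (hecke_relations m :: (word \<Rightarrow>\<^sub>0 'f) set)"
    unfolding hecke_relations_def by (intro Un_mono) blast+
  then have "hecke_relations n \<subseteq> ?I"
    using hecke_relations_subset hecke_relations_in_ideal by blast
  ultimately have "hecke_ideal n \<subseteq> ?I"
    unfolding hecke_ideal_eq[of n] by (rule ring.genideal_minimal[OF free_algebra_ring])
  then show ?thesis by blast
qed

lemma hecke_incl_cls:
  assumes "n \<le> m"
  shows "hecke_incl m (hecke.cls n p) = hecke.cls m p"
proof -
  have "hecke.cls m p' = hecke.cls m p" if "p' \<in> hecke.cls n p" for p'
    using that hecke_ideal_mono[OF assms] by (intro hecke.cls_eq) (auto simp: hecke.cls_iff)
  then have "(\<Union>p'\<in>hecke.cls n p. hecke.cls m p') = (\<Union>p'\<in>hecke.cls n p. hecke.cls m p)"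
    by (rule SUP_cong[OF refl])
  also have "\<dots> = hecke.cls m p"
    using hecke.cls_self[of p n] by blast
  finally show ?thesis by (simp add: hecke_incl_def hecke.cls_def)
qed

lemma hecke_incl_word: "n \<le> m \<Longrightarrow> hecke_incl m (hecke_word n u) = hecke_word m u"
  by (simp add: hecke_word_eq hecke_incl_cls)

lemma hecke_incl_carrier:
  assumes "n \<le> m" "x \<in> carrier (hecke_algebra n)"
  shows "hecke_incl m x \<in> carrier (hecke_algebra m)" "coset_op (hecke_incl m x) q = coset_op x q"
  using assms free_carrier_mono[OF assms(1)]
  by (auto simp: hecke_algebra_eq hecke.carrier_Q hecke_incl_cls)

lemma hecke_word_carrier: "u \<in> lists {1..<n} \<Longrightarrow> hecke_word n u \<in> carrier (hecke_algebra n)"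
  by (simp add: hecke_word_eq hecke_algebra_eq hecke.carrier_Q free_carrier_single)

lemma hecke_word_mult:
  assumes "u \<in> lists {1..<n}" "v \<in> lists {1..<n}"
  shows "hecke_word n u \<otimes>\<^bsub>hecke_algebra n\<^esub> hecke_word n v = hecke_word n (u @ v)"
  using assms by (simp add: hecke_word_eq hecke_algebra_eq hecke.Q_mult free_carrier_single mult_single)

lemma hecke_one: "\<one>\<^bsub>hecke_algebra n\<^esub> = hecke_word n []"
  by (simp add: hecke_word_eq hecke_algebra_eq hecke.Q_one zero_word_def[symmetric])

section \<open>Every word is equivalent to a reduced one\<close>

text \<open>The \<open>itself\<close> argument fixes the coefficient field, which words alone do not
  determine.\<close>

definition word_equiv :: "'f::field itself \<Rightarrow> nat \<Rightarrow> nat list \<Rightarrow> nat list \<Rightarrow> bool" where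
  "word_equiv t n u v \<longleftrightarrow> u \<in> lists {1..<n} \<and> v \<in> lists {1..<n} \<and>
     hecke_word n u = (hecke_word n v :: (word \<Rightarrow>\<^sub>0 'f::field) set)"

lemma word_equiv_refl: "u \<in> lists {1..<n} \<Longrightarrow> word_equiv t n u u"
  by (simp add: word_equiv_def)

lemma word_equiv_trans [trans]: "word_equiv t n u v \<Longrightarrow> word_equiv t n v w \<Longrightarrow> word_equiv t n u w"
  by (simp add: word_equiv_def)

lemma word_equiv_cong:
  assumes "word_equiv (t :: 'f::field itself) n u v" "a \<in> lists {1..<n}" "b \<in> lists {1..<n}"
  shows "word_equiv t n (a @ u @ b) (a @ v @ b)"
proof -
  have "hecke_word n (a @ u @ b) = (hecke_word n (a @ v @ b) :: (word \<Rightarrow>\<^sub>0 'f) set)"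
    if "u \<in> lists {1..<n}" "v \<in> lists {1..<n}" "hecke_word n u = (hecke_word n v :: (word \<Rightarrow>\<^sub>0 'f) set)"
    using hecke_word_mult[of a n "u @ b", where ?'a='f] hecke_word_mult[of u n b, where ?'a='f]
      hecke_word_mult[of a n "v @ b", where ?'a='f] hecke_word_mult[of v n b, where ?'a='f] assms(2,3) that
    by (simp del: One_nat_def in_lists_conv_set)
  then show ?thesis using assms by (simp add: word_equiv_def)
qed

lemma word_equiv_relation:
  fixes t :: "'f::field itself"
  assumes "Poly_Mapping.single (Word u) 1 - Poly_Mapping.single (Word v) 1 \<in> (hecke_relations n :: (word \<Rightarrow>\<^sub>0 'f) set)"
    "u \<in> lists {1..<n}" "v \<in> lists {1..<n}"
  shows "word_equiv t n u v"
proof -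
  have "hecke.cls n (Poly_Mapping.single (Word u) 1) = hecke.cls n (Poly_Mapping.single (Word v) (1 :: 'f))"
    by (rule hecke.cls_eq) (use assms(1) hecke_relations_in_ideal in blast)
  then show ?thesis using assms(2,3) by (simp add: word_equiv_def hecke_word_eq)
qed

lemma word_equiv_idem:
  assumes "i \<in> {1..<n}"
  shows "word_equiv t n [i, i] [i]"
  by (rule word_equiv_relation)
    (use assms in \<open>auto simp: hecke_relations_def mult_single simp del: One_nat_def intro!: exI[of _ i]\<close>)

lemma word_equiv_braid:
  assumes "i \<in> {1..<n}" "Suc i \<in> {1..<n}"
  shows "word_equiv t n [Suc i, i, Suc i] [i, Suc i, i]"
proof -
  have "word_equiv t n [i, Suc i, i] [Suc i, i, Suc i]"
    by (rule word_equiv_relation)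
      (use assms in \<open>auto simp: hecke_relations_def mult_single simp del: One_nat_def\<close>)
  then show ?thesis by (simp add: word_equiv_def)
qed

lemma word_equiv_commute:
  fixes t :: "'f::field itself"
  assumes "i \<in> {1..<n}" "j \<in> {1..<n}" "i + 1 < j \<or> j + 1 < i"
  shows "word_equiv t n [i, j] [j, i]"
proof (rule word_equiv_relation)
  have "free_gen i * free_gen j - free_gen j * free_gen i \<in> (hecke_relations n :: (word \<Rightarrow>\<^sub>0 'f) set)"
    unfolding hecke_relations_def using assms by blast
  then show "Poly_Mapping.single (Word [i, j]) 1 - Poly_Mapping.single (Word [j, i]) 1
      \<in> (hecke_relations n :: (word \<Rightarrow>\<^sub>0 'f) set)"
    by (simp add: mult_single)
qed (use assms in auto)

lemma word_equiv_commute_list: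
  assumes "c \<in> lists {1..<n}" "j \<in> {1..<n}" "\<And>i. i \<in> set c \<Longrightarrow> i + 1 < j \<or> j + 1 < i"
  shows "word_equiv t n (c @ [j]) (j # c)"
  using assms
proof (induction c rule: list.induct)
  case Nil
  then show ?case by (simp add: word_equiv_refl)
next
  case (Cons i c)
  have i: "i \<in> {1..<n}" and c: "c \<in> lists {1..<n}" using Cons.prems(1) by auto
  have IH: "word_equiv t n (c @ [j]) (j # c)"
    by (rule Cons.IH[OF c Cons.prems(2)]) (use Cons.prems(3) in auto)
  have "word_equiv t n ([i] @ (c @ [j]) @ []) ([i] @ (j # c) @ [])"
    using word_equiv_cong[OF IH, of "[i]" "[]"] i by simp
  also have "word_equiv t n ([i] @ (j # c) @ []) (j # i # c)"
    using word_equiv_cong[OF word_equiv_commute[OF i Cons.prems(2) Cons.prems(3)], of "[]" c] c by simp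
  finally show ?case by simp
qed

section \<open>Normal form of words by descending runs\<close>

definition descent :: "nat \<Rightarrow> nat \<Rightarrow> nat list" where
  "descent k m = rev [k..<Suc m]"

lemma set_descent [simp]: "set (descent k m) = {k..m}"
  by (auto simp: descent_def)

lemma descent_empty [simp]: "descent (Suc m) m = []"
  by (simp add: descent_def)

lemma descent_Suc: "k \<le> m \<Longrightarrow> descent k m = descent (Suc k) m @ [k]"
  unfolding descent_def by (subst upt_conv_Cons) simp_all

lemma descent_lists: "1 \<le> k \<Longrightarrow> m < n \<Longrightarrow> descent k m \<in> lists {1..<n}"
  by auto

text \<open>The runs with k from 1 to m + 1 represent the cosets S_m w in S_{m+1}. An appended
  letter j passes to the front if j + 1 < k, lengthens the run if j + 1 = k, is absorbed by
  idempotency if j = k, and leaves on the left as j - 1 if k < j.\<close>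

lemma descent_snoc:
  assumes "w \<in> lists {1..<m}" "k \<in> {1..Suc m}" "j \<in> {1..<Suc m}" "m < n"
  shows "\<exists>w'\<in>lists {1..<m}. \<exists>k'\<in>{1..Suc m}. word_equiv t n (w @ descent k m @ [j]) (w' @ descent k' m)"
proof -
  have wn: "w \<in> lists {1..<n}" and jn: "j \<in> {1..<n}" using assms by auto
  have dn: "descent k' m \<in> lists {1..<n}" if "1 \<le> k'" for k' using that assms(4) by (rule descent_lists)
  consider "j + 1 < k" | "j + 1 = k" | "j = k" | "k < j" by linarith
  then show ?thesis
  proof cases
    case 1
    have "word_equiv t n (descent k m @ [j]) (j # descent k m)"
      using dn[of k] assms(2) 1 by (intro word_equiv_commute_list jn) auto
    from word_equiv_cong[OF this wn, of "[]"]
    have "word_equiv t n (w @ descent k m @ [j]) ((w @ [j]) @ descent k m)" by simp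
    moreover have "w @ [j] \<in> lists {1..<m}" using assms 1 by auto
    ultimately show ?thesis using assms(2) by blast
  next
    case 2
    have "descent j m = descent k m @ [j]"
      using 2 assms(3) descent_Suc[of j m] by simp
    moreover have "word_equiv t n (w @ descent j m) (w @ descent j m)"
      using wn dn[of j] assms(3) by (intro word_equiv_refl) auto
    ultimately have "word_equiv t n (w @ descent k m @ [j]) (w @ descent j m)" by simp
    moreover have "j \<in> {1..Suc m}" using assms(3) by auto
    ultimately show ?thesis using assms(1) by blast
  next
    case 3
    have d: "descent k m = descent (Suc k) m @ [k]"
      using 3 assms(3) by (intro descent_Suc) simp
    have "word_equiv t n ((w @ descent (Suc k) m) @ [k, k] @ []) ((w @ descent (Suc k) m) @ [k] @ [])"
      using word_equiv_idem[of k n t] jn 3 wn dn[of "Suc k"] by (intro word_equiv_cong) auto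
    then have "word_equiv t n (w @ descent k m @ [j]) (w @ descent k m)"
      using d 3 by simp
    then show ?thesis using assms(1,2) by blast
  next
    case 4
    define i where "i = j - 1"
    have j: "j = Suc i" and ki: "k \<le> i" using 4 by (auto simp: i_def)
    have i1: "1 \<le> i" using ki assms(2) by auto
    let ?L = "rev [k..<i]"
    have L: "?L \<in> lists {1..<n}" using jn ki assms(2) j by auto
    have D: "descent (Suc j) m \<in> lists {1..<n}" by (rule dn) simp
    \<comment> \<open>The run m, ..., k is cut around its letters j and i = j - 1; \<open>?L\<close>
      is its tail i - 1, ..., k, with every letter of which j commutes.\<close>
    have d: "descent k m = descent (Suc j) m @ [j, i] @ ?L"
    proof -
      note upt_Suc [simp del]
      have "[k..<Suc m] = [k..<i] @ [i..<Suc m]"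
        using upt_add_eq_append[of k i "Suc m - i"] ki assms(3) j by simp
      also have "[i..<Suc m] = i # j # [Suc j..<Suc m]"
        using assms(3) j by (simp add: upt_conv_Cons)
      finally show ?thesis by (simp add: descent_def)
    qed
    have "word_equiv t n (?L @ [j]) (j # ?L)"
      using L jn j by (intro word_equiv_commute_list) auto
    from word_equiv_cong[OF this, of "w @ descent (Suc j) m @ [j, i]" "[]"]
    have "word_equiv t n (w @ descent k m @ [j]) (w @ descent (Suc j) m @ [j, i, j] @ ?L)"
      using wn D jn j i1 unfolding d by simp
    also have "word_equiv t n \<dots> (w @ descent (Suc j) m @ [i, j, i] @ ?L)"
      using word_equiv_cong[OF word_equiv_braid[of i n t], of "w @ descent (Suc j) m" ?L] wn D L jn j i1
      by simp
    \<comment> \<open>All letters of \<open>descent (Suc j) m\<close> exceed i + 1, so the first i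
      moves in front of them, and the letters j, i that stay behind complete the run again.\<close>
    also have "word_equiv t n \<dots> (w @ (i # descent (Suc j) m) @ [j, i] @ ?L)"
    proof -
      have "word_equiv t n (descent (Suc j) m @ [i]) (i # descent (Suc j) m)"
        using D jn j i1 by (intro word_equiv_commute_list) auto
      from word_equiv_cong[OF this wn, of "[j, i] @ ?L"] show ?thesis
        using L jn j i1 by simp
    qed
    finally have "word_equiv t n (w @ descent k m @ [j]) ((w @ [i]) @ descent k m)"
      unfolding d by simp
    moreover have "w @ [i] \<in> lists {1..<m}" using assms(1,3) j i1 by auto
    ultimately show ?thesis using assms(2) by blast
  qed
qed

text \<open>The letters are absorbed one by one with \<open>descent_snoc\<close>, starting from the
  empty run, which is the one with k = m + 1.\<close>

lemma word_equiv_descent: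
  assumes "u \<in> lists {1..<Suc m}" "m < n"
  shows "\<exists>w\<in>lists {1..<m}. \<exists>k\<in>{1..Suc m}. word_equiv t n u (w @ descent k m)"
  using assms(1)
proof (induction u rule: rev_induct)
  case Nil
  have "word_equiv t n [] ([] @ descent (Suc m) m)" by (simp add: word_equiv_refl)
  then show ?case by (intro bexI[of _ "[]"] bexI[of _ "Suc m"]) auto
next
  case (snoc j u)
  then have "u \<in> lists {1..<Suc m}" by auto
  from snoc.IH[OF this] obtain w k
    where wk: "w \<in> lists {1..<m}" "k \<in> {1..Suc m}" "word_equiv t n u (w @ descent k m)"
    by blast
  have j: "j \<in> {1..<Suc m}" using snoc.prems by auto
  have "word_equiv t n (u @ [j]) (w @ descent k m @ [j])"
    using word_equiv_cong[OF wk(3), of "[]" "[j]"] j assms(2) by simp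
  with descent_snoc[OF wk(1,2) j assms(2)] show ?case
    by (meson word_equiv_trans)
qed

section \<open>Inversions and reduced words\<close>

definition inversions :: "nat \<Rightarrow> (nat \<Rightarrow> nat) \<Rightarrow> (nat \<times> nat) set" where
  "inversions n f = {(a, b). 1 \<le> a \<and> a < b \<and> b \<le> n \<and> f b < f a}"

lemma finite_inversions: "finite (inversions n f)"
  by (rule finite_subset[of _ "{..n} \<times> {..n}"]) (auto simp: inversions_def)

text \<open>Precomposition with s_i relabels positions and reverses the order of i and i + 1 only,
  so no pair other than this one can be a new inversion.\<close>

lemma inversions_transpose_subset:
  assumes "i \<in> {1..<n}"
  shows "inversions n (f \<circ> transpose i (Suc i)) \<subseteq>
    insert (i, Suc i) (map_prod (transpose i (Suc i)) (transpose i (Suc i)) ` inversions n f)"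
proof clarify
  fix a b
  let ?t = "transpose i (Suc i)"
  assume ab: "(a, b) \<in> inversions n (f \<circ> ?t)"
    and notin: "(a, b) \<notin> map_prod ?t ?t ` inversions n f"
  have "(?t a, ?t b) \<notin> inversions n f"
    using notin by (metis map_prod_imageI transpose_involutory)
  then show "a = i \<and> b = Suc i"
    using ab assms by (auto simp: inversions_def transpose_def split: if_splits)
qed

lemma card_inversions_transpose_le:
  assumes "i \<in> {1..<n}"
  shows "card (inversions n (f \<circ> transpose i (Suc i))) \<le> Suc (card (inversions n f))"
proof -
  let ?t = "transpose i (Suc i)"
  have "card (inversions n (f \<circ> ?t)) \<le> card (insert (i, Suc i) (map_prod ?t ?t ` inversions n f))"
    using inversions_transpose_subset[OF assms] by (intro card_mono) (auto simp: finite_inversions)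
  also have "\<dots> \<le> Suc (card (map_prod ?t ?t ` inversions n f))"
    by (simp add: card_insert_if finite_inversions)
  also have "\<dots> \<le> Suc (card (inversions n f))"
    by (simp add: card_image_le finite_inversions)
  finally show ?thesis .
qed

text \<open>At an ascent every relabelled inversion survives, and the pair (i, i + 1) is added to
  them.\<close>

lemma card_inversions_transpose_ascent:
  assumes "i \<in> {1..<n}" "f i < f (Suc i)"
  shows "card (inversions n (f \<circ> transpose i (Suc i))) = Suc (card (inversions n f))"
proof (rule antisym[OF card_inversions_transpose_le[OF assms(1)]])
  let ?t = "transpose i (Suc i)"
  have "inj (map_prod ?t ?t)" by (simp add: prod.inj_map)
  then have "card (map_prod ?t ?t ` inversions n f) = card (inversions n f)"
    by (intro card_image) (meson inj_on_subset subset_UNIV)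
  moreover have "(i, Suc i) \<notin> map_prod ?t ?t ` inversions n f"
    by (auto simp: inversions_def transpose_def split: if_splits)
  ultimately have card: "Suc (card (inversions n f)) = card (insert (i, Suc i) (map_prod ?t ?t ` inversions n f))"
    by (simp add: finite_inversions)
  have "insert (i, Suc i) (map_prod ?t ?t ` inversions n f) \<subseteq> inversions n (f \<circ> ?t)"
  proof
    fix z assume "z \<in> insert (i, Suc i) (map_prod ?t ?t ` inversions n f)"
    then show "z \<in> inversions n (f \<circ> ?t)"
      using assms by (auto simp: inversions_def transpose_def split: if_splits)
  qed
  then have "card (insert (i, Suc i) (map_prod ?t ?t ` inversions n f)) \<le> card (inversions n (f \<circ> ?t))"
    by (rule card_mono[OF finite_inversions])
  then show "Suc (card (inversions n f)) \<le> card (inversions n (f \<circ> ?t))" using card by simp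
qed

lemma inversions_id [simp]: "inversions n (\<lambda>x. x) = {}"
  by (auto simp: inversions_def)

lemma word_perm_Nil [simp]: "word_perm [] = (\<lambda>x. x)"
  by (simp add: word_perm_def id_def)

lemma word_perm_Cons: "word_perm (i # u) = transpose i (Suc i) \<circ> word_perm u"
  by (simp add: word_perm_def)

lemma word_perm_append: "word_perm (u @ v) = word_perm u \<circ> word_perm v"
  by (induction u) (simp_all add: word_perm_Cons comp_assoc)

lemma word_perm_snoc: "word_perm (u @ [i]) = word_perm u \<circ> transpose i (Suc i)"
  by (simp add: word_perm_append word_perm_Cons fun_eq_iff)

lemma word_perm_permutes:
  assumes "u \<in> lists {1..<n}"
  shows "word_perm u permutes {1..n}"
  using assms
proof induction
  case Nil
  then show ?case by (simp add: permutes_id[unfolded id_def])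
next
  case (Cons i u)
  have "transpose i (Suc i) permutes {1..n}"
    using Cons.hyps by (intro permutes_swap_id) auto
  then have "transpose i (Suc i) \<circ> word_perm u permutes {1..n}"
    using Cons.IH by (rule permutes_compose[rotated])
  then show ?case by (simp only: word_perm_Cons)
qed

lemma card_inversions_word_perm_le:
  assumes "u \<in> lists {1..<n}"
  shows "card (inversions n (word_perm u)) \<le> length u"
  using assms
proof (induction u rule: rev_induct)
  case Nil
  then show ?case by simp
next
  case (snoc i u)
  have "u \<in> lists {1..<n}" "i \<in> {1..<n}" using snoc.prems by auto
  then show ?case
    using card_inversions_transpose_le[of i n "word_perm u"] snoc.IH by (simp add: word_perm_snoc o_def)
qed

text \<open>The number of inversions bounds from below the length of every word for the permutation,
  so a word that attains it is shortest.\<close>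

lemma reduced_expressionI:
  assumes "u \<in> lists {1..<n}" "card (inversions n (word_perm u)) = length u"
  shows "reduced_expression n (word_perm u) u"
  unfolding reduced_expression_def
proof (intro conjI ballI impI assms(1) refl)
  fix v assume v: "v \<in> lists {1..<n}" "word_perm v = word_perm u"
  show "length u \<le> length v"
    using card_inversions_word_perm_le[OF v(1)] unfolding v(2) assms(2) .
qed

text \<open>Along the run the largest value m + 1 travels from position m + 1 down to position k.
  Each swap exchanges it with a smaller value on its left, hence occurs at an ascent and adds
  exactly one inversion. The clause on positions below k keeps track of that smaller value.\<close>

lemma word_perm_descent:
  assumes v: "v \<in> lists {1..<m}" and mn: "m < n" and k: "1 \<le> k" "k \<le> Suc m"
    and card: "card (inversions n (word_perm v)) = length v"
  shows "word_perm (v @ descent k m) k = Suc m \<and> (\<forall>i<k. word_perm (v @ descent k m) i = word_perm v i) \<and>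
    card (inversions n (word_perm (v @ descent k m))) = length (v @ descent k m)"
  using k(2,1)
proof (induction k rule: inc_induct)
  case base
  have "word_perm v (Suc m) = Suc m"
    by (rule permutes_not_in[OF word_perm_permutes[OF v]]) auto
  then show ?case using card by simp
next
  case (step k)
  let ?f = "word_perm (v @ descent (Suc k) m)"
  have d: "v @ descent k m = (v @ descent (Suc k) m) @ [k]"
    using step.hyps by (simp add: descent_Suc)
  have IH: "?f (Suc k) = Suc m" "\<forall>i<Suc k. ?f i = word_perm v i"
    "card (inversions n ?f) = length (v @ descent (Suc k) m)"
    using step by auto
  have "word_perm v k \<in> {1..m}"
    using permutes_in_image[OF word_perm_permutes[OF v], of k] step by auto
  then have "?f k < ?f (Suc k)" using IH by auto
  then have "card (inversions n (?f \<circ> transpose k (Suc k))) = Suc (card (inversions n ?f))"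
    using step mn by (intro card_inversions_transpose_ascent) auto
  moreover have "(?f \<circ> transpose k (Suc k)) i = word_perm v i" if "i < k" for i
    using IH(2) that by simp
  ultimately show ?case
    unfolding d word_perm_snoc using IH by (simp add: o_def)
qed

text \<open>Induction on m with n fixed: the word splits into a word for m and a run, the former is
  made reduced, and the run keeps the count exact.\<close>

lemma exists_reduced_word:
  assumes "u \<in> lists {1..<m}" "m \<le> n"
  shows "\<exists>v\<in>lists {1..<m}. word_equiv t n u v \<and> card (inversions n (word_perm v)) = length v"
  using assms
proof (induction m arbitrary: u)
  case 0
  then have "u = []" by auto
  then show ?case by (intro bexI[of _ "[]"]) (auto simp: word_equiv_refl)
next
  case (Suc m)
  then have "m < n" by simp
  from word_equiv_descent[OF Suc.prems(1) this, of t] obtain w k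
    where wk: "w \<in> lists {1..<m}" "k \<in> {1..Suc m}" "word_equiv t n u (w @ descent k m)"
    by blast
  from Suc.IH[OF wk(1)] Suc.prems obtain v where v: "v \<in> lists {1..<m}" "word_equiv t n w v"
    "card (inversions n (word_perm v)) = length v" by auto
  have d: "descent k m \<in> lists {1..<Suc m}" using wk(2) by auto
  have "word_equiv t n u (v @ descent k m)"
    using word_equiv_trans[OF wk(3)] word_equiv_cong[OF v(2), of "[]" "descent k m"] d Suc.prems(2) by fastforce
  moreover have "card (inversions n (word_perm (v @ descent k m))) = length (v @ descent k m)"
    using word_perm_descent[OF v(1) _ _ _ v(3), of k] wk(2) Suc.prems(2) by auto
  moreover have "v @ descent k m \<in> lists {1..<Suc m}" using v(1) d by auto
  ultimately show ?case by blast
qed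

text \<open>In this form closure of the monoid under multiplication is just concatenation of
  words.\<close>

lemma hecke_monoid_eq:
  "(hecke_monoid n :: (word \<Rightarrow>\<^sub>0 'f::field) set set) = hecke_word n ` lists {1..<n}"
proof
  show "hecke_monoid n \<subseteq> (hecke_word n ` lists {1..<n} :: (word \<Rightarrow>\<^sub>0 'f) set set)"
    by (auto simp: hecke_monoid_def reduced_expression_def simp del: in_lists_conv_set)
  show "hecke_word n ` lists {1..<n} \<subseteq> (hecke_monoid n :: (word \<Rightarrow>\<^sub>0 'f) set set)"
  proof
    fix x :: "(word \<Rightarrow>\<^sub>0 'f) set" assume "x \<in> hecke_word n ` lists {1..<n}"
    then obtain u where u: "u \<in> lists {1..<n}" "x = hecke_word n u" by blast
    from exists_reduced_word[OF u(1) order_refl, of "TYPE('f)"]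
    obtain v where v: "v \<in> lists {1..<n}" "x = hecke_word n v"
      "card (inversions n (word_perm v)) = length v"
      using u(2) by (auto simp: word_equiv_def)
    then show "x \<in> hecke_monoid n"
      using reduced_expressionI[OF v(1,3)] word_perm_permutes[OF v(1)]
      unfolding hecke_monoid_def by blast
  qed
qed

section \<open>Multichains and the graded pieces\<close>

definition multichain_monomial :: "nat set list \<Rightarrow> (nat set \<Rightarrow>\<^sub>0 nat)" where
  "multichain_monomial M = (\<Sum>A\<leftarrow>M. Poly_Mapping.single A 1)"

lemma prod_list_poly_var:
  "prod_list (map poly_var M) = Poly_Mapping.single (multichain_monomial M) (1 :: 'f::field)"
  by (induction M) (simp_all add: multichain_monomial_def mult_single)

lemma y_monomial_eq: "y_monomial n M = SR.cls n (Poly_Mapping.single (multichain_monomial M) 1)"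
  by (simp add: y_monomial_def SR.cls_def prod_list_poly_var del: One_nat_def)

lemma keys_multichain_monomial [simp]: "Poly_Mapping.keys (multichain_monomial M) = set M"
  by (induction M) (simp_all add: multichain_monomial_def keys_add_nat)

lemma chain_multichain_monomial:
  assumes "M \<in> multichains n"
  shows "chain_monomial (multichain_monomial M)"
proof -
  have "\<forall>A\<in>set M. \<forall>B\<in>set M. A \<subseteq> B \<or> B \<subseteq> A" if "sorted_wrt (\<subseteq>) M" for M :: "nat set list"
    using that by (induction M) auto
  from this[of M] assms show ?thesis
    unfolding multichains_def chain_monomial_def keys_multichain_monomial by blast
qed

lemma swap_monomial_add: "swap_monomial i (a + b) = swap_monomial i a + swap_monomial i b"
  by (rule poly_mapping_eqI) (simp add: lookup_swap_monomial lookup_add)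

lemma swap_monomial_single:
  "swap_monomial i (Poly_Mapping.single A c) = Poly_Mapping.single (transpose i (Suc i) ` A) c"
proof (rule poly_mapping_eqI)
  fix B
  have "A = transpose i (Suc i) ` B \<longleftrightarrow> transpose i (Suc i) ` A = B" by auto
  then show "Poly_Mapping.lookup (swap_monomial i (Poly_Mapping.single A c)) B =
      Poly_Mapping.lookup (Poly_Mapping.single (transpose i (Suc i) ` A) c) B"
    by (simp add: lookup_swap_monomial lookup_single)
qed

lemma swap_multichain_monomial:
  "swap_monomial i (multichain_monomial M) = multichain_monomial (swap_chain i M)"
proof (induction M)
  case Nil
  show ?case by (rule poly_mapping_eqI) (simp add: lookup_swap_monomial multichain_monomial_def swap_chain_def)
next
  case (Cons A M)
  then show ?case
    by (simp add: multichain_monomial_def swap_monomial_add swap_monomial_single swap_chain_def)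
qed

lemma swap_chain_swap_chain [simp]: "swap_chain i (swap_chain i M) = M"
  by (simp add: swap_chain_def o_def)

lemma swap_chain_multichains:
  assumes "M \<in> multichains n" "i \<in> {1..<n}"
  shows "swap_chain i M \<in> multichains n"
proof -
  have "transpose i (Suc i) ` A \<subseteq> {1..n}" if "A \<subseteq> {1..n}" for A
    using that assms(2) by (auto simp: transpose_def)
  moreover have "sorted_wrt (\<subseteq>) (swap_chain i M)" if "sorted_wrt (\<subseteq>) M" for M
    using that by (simp add: swap_chain_def sorted_wrt_map inj_image_subset_iff)
  ultimately show ?thesis
    using assms(1) by (auto simp: multichains_def swap_chain_def simp del: atLeastAtMost_iff)
qed

lemma card_swap_chain: "map card (swap_chain i M) = map card M"
  by (simp add: swap_chain_def card_image)

lemma multichains_mono: "n \<le> m \<Longrightarrow> multichains n \<subseteq> multichains m"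
  by (force simp: multichains_def)

lemma precedes_multichain_monomial:
  "precedes (multichain_monomial M) a b \<longleftrightarrow> (\<exists>A\<in>set M. a \<in> A \<and> b \<notin> A)"
  by (simp add: precedes_def)

text \<open>In a chain, a enters strictly before b exactly when some member contains a and omits
  b.\<close>

lemma chain_pos_less_iff:
  assumes M: "M \<in> multichains n" and a: "a \<in> {1..n}" and b: "b \<in> {1..n}"
  shows "chain_pos n M a < chain_pos n M b \<longleftrightarrow> precedes (multichain_monomial M) a b"
proof -
  let ?L = "M @ [{1..n}]" and ?k = "length M"
  define P where "P i j \<longleftrightarrow> j \<in> {1..?k + 1} \<and> i \<in> ?L ! (j - 1)" for i j
  have pos: "chain_pos n M i = (LEAST j. P i j)" for i
    by (simp add: chain_pos_def P_def)
  have P: "P i (chain_pos n M i)" if "i \<in> {1..n}" for i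
    unfolding pos by (rule LeastI[of _ "?k + 1"]) (use that in \<open>simp add: P_def nth_append\<close>)
  have sorted: "sorted_wrt (\<subseteq>) ?L"
    using M by (auto simp: multichains_def sorted_wrt_append)
  show ?thesis
  proof
    assume less: "chain_pos n M a < chain_pos n M b"
    let ?j = "chain_pos n M a"
    have j: "P a ?j" by (rule P[OF a])
    have "\<not> P b ?j" using not_less_Least[of ?j "P b"] less by (simp add: pos)
    then have nb: "b \<notin> ?L ! (?j - 1)" using j by (simp add: P_def)
    \<comment> \<open>The closing entry [n] contains b, so the set that separates a from b is a
      genuine member of M.\<close>
    then have "?j - 1 \<noteq> ?k" using b by (auto simp: nth_append)
    then have "?j - 1 < ?k" using j by (auto simp: P_def)
    then have "?L ! (?j - 1) \<in> set M" by (simp add: nth_append)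
    then show "precedes (multichain_monomial M) a b"
      using j nb unfolding precedes_multichain_monomial P_def by blast
  next
    assume "precedes (multichain_monomial M) a b"
    then obtain t where t: "t < ?k" "a \<in> M ! t" "b \<notin> M ! t"
      by (auto simp: precedes_multichain_monomial in_set_conv_nth)
    have "P a (Suc t)" using t by (simp add: P_def nth_append)
    then have le: "chain_pos n M a \<le> Suc t" unfolding pos by (rule Least_le)
    have Pb: "P b (chain_pos n M b)" by (rule P[OF b])
    show "chain_pos n M a < chain_pos n M b"
    proof (rule ccontr)
      assume "\<not> chain_pos n M a < chain_pos n M b"
      \<comment> \<open>\<open>chain_pos\<close> counts from 1 and \<open>!\<close> from 0. If b
        entered no later than a, the set where it enters would lie inside \<open>M ! t\<close>,
        which omits b.\<close>
      then have "chain_pos n M b - 1 \<le> t" using le by simp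
      then have "?L ! (chain_pos n M b - 1) \<subseteq> ?L ! t"
        using sorted_wrt_nth_less[OF sorted, of "chain_pos n M b - 1" t] t(1)
        by (cases "chain_pos n M b - 1 = t") auto
      then show False using Pb t by (auto simp: P_def nth_append)
    qed
  qed
qed

section \<open>The monomial basis of a graded piece\<close>

definition graded_monomials :: "nat list \<Rightarrow> nat \<Rightarrow> (nat set \<Rightarrow>\<^sub>0 nat) set" where
  "graded_monomials g n = multichain_monomial ` {M \<in> multichains n. map card M = g}"

lemma graded_monomials_subset: "graded_monomials g n \<subseteq> {m \<in> poly_monomials n. chain_monomial m}"
  using chain_multichain_monomial
  by (auto simp: graded_monomials_def poly_monomials_def multichains_def simp del: atLeastAtMost_iff) 

lemma graded_monomials_mono: "n \<le> m \<Longrightarrow> graded_monomials g n \<subseteq> graded_monomials g m"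
  unfolding graded_monomials_def using multichains_mono by blast

lemma swap_graded_monomials:
  assumes "m \<in> graded_monomials g n" "i \<in> {1..<n}"
  shows "swap_monomial i m \<in> graded_monomials g n"
proof -
  from assms(1) obtain M where M: "M \<in> multichains n" "map card M = g" "m = multichain_monomial M"
    by (auto simp: graded_monomials_def)
  have "swap_chain i M \<in> multichains n \<and> map card (swap_chain i M) = g"
    using swap_chain_multichains[OF M(1) assms(2)] card_swap_chain[of i M] M(2) by simp
  then show ?thesis
    unfolding M(3) swap_multichain_monomial graded_monomials_def by blast
qed

lemma keys_graded_poly_carrier:
  "Poly_Mapping.keys q \<subseteq> graded_monomials g n \<Longrightarrow> q \<in> poly_carrier n"
  using graded_monomials_subset[of g n] by (auto simp: poly_carrier_def)

lemma carrier_boolean_SR_graded: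
  "carrier (boolean_SR_graded g n :: ('f::field, 'f boolean_poly set) module) =
     SR.cls n ` {q. Poly_Mapping.keys q \<subseteq> graded_monomials g n}"
proof -
  have "{y_monomial n M | M. M \<in> multichains n \<and> map card M = g} =
      (\<lambda>m. SR.cls n (Poly_Mapping.single m (1 :: 'f))) ` graded_monomials g n"
    by (auto simp: graded_monomials_def y_monomial_eq)
  moreover have "{q. Poly_Mapping.keys q \<subseteq> graded_monomials g n} \<subseteq> (poly_carrier n :: 'f boolean_poly set)"
    using keys_graded_poly_carrier by blast
  ultimately show ?thesis
    by (simp add: boolean_SR_graded_def boolean_SR_def SR.linear_span_cls)
qed

lemma SR_cls_iff: "p \<in> SR.cls n q \<longleftrightarrow> p - q \<in> nonchain_ideal n"
  by (subst SR.cls_iff) (subst boolean_ideal_eq, rule refl)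

lemma SR_cls_eq: "p - q \<in> nonchain_ideal n \<Longrightarrow> SR.cls n p = SR.cls n q"
  by (rule SR.cls_eq) (subst boolean_ideal_eq)

text \<open>The difference of two lifts is supported on chains, whereas elements of the ideal are
  supported on non-chains. Thus every element of a graded piece has exactly one lift over
  \<open>graded_monomials\<close>.\<close>

lemma graded_cls_inject:
  assumes "SR.cls n p = SR.cls n q"
    "Poly_Mapping.keys p \<subseteq> graded_monomials g n" "Poly_Mapping.keys q \<subseteq> graded_monomials g n"
  shows "p = q"
proof -
  have "p - q \<in> nonchain_ideal n"
    using SR.cls_eqD[OF assms(1)] by (simp add: boolean_ideal_eq)
  moreover have "Poly_Mapping.keys (p - q) \<subseteq> graded_monomials g n"
    using assms(2,3) by (rule keys_diff_subset)
  ultimately have "Poly_Mapping.keys (p - q) = {}"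
    using graded_monomials_subset[of g n] unfolding nonchain_ideal_def by blast
  then show ?thesis by simp
qed

lemma module_boolean_SR_graded:
  "module (ring_of_type_algebra :: 'f::field ring) (boolean_SR_graded g n)"
proof -
  have "submodule (carrier (boolean_SR_graded g n)) (ring_of_type_algebra :: 'f ring) (SR.Q n)"
    unfolding carrier_boolean_SR_graded
    by (rule SR.submodule_cls) (use keys_graded_poly_carrier in blast)
  from submodule.submodule_is_module[OF this SR.Q_module]
  show ?thesis by (simp add: boolean_SR_graded_def boolean_SR_def)
qed

lemma graded_ops [simp]:
  "ring.add (boolean_SR_graded g n) = ring.add (SR.Q n)"
  "ring.zero (boolean_SR_graded g n) = ring.zero (SR.Q n)"
  "module.smult (boolean_SR_graded g n) = module.smult (SR.Q n)"
  by (simp_all add: boolean_SR_graded_def boolean_SR_def)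

section \<open>The action on the whole Stanley-Reisner ring\<close>

text \<open>\<open>restricted_boolean_action\<close> asks for an action on the whole ring that
  restricts to the graded one. Here a lift is determined only up to non-chain terms, and any one is
  taken.\<close>

definition SR_action :: "nat \<Rightarrow> (word \<Rightarrow>\<^sub>0 'f::field) set \<Rightarrow> 'f boolean_poly set \<Rightarrow> 'f boolean_poly set" where
  "SR_action n x v = SR.cls n (coset_op x (SOME q. q \<in> v))"

lemma coset_op_poly_carrier:
  assumes "x \<in> carrier (hecke_algebra n)" "q \<in> poly_carrier n"
  shows "coset_op x q \<in> poly_carrier n"
proof -
  have "swap_monomial i m \<in> poly_monomials n" if "i \<in> {1..<n}" "m \<in> poly_monomials n" for i m
  proof -
    have "transpose i (Suc i) ` A \<subseteq> {1..n}" if "A \<subseteq> {1..n}" for A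
      using that \<open>i \<in> {1..<n}\<close> by (auto simp: transpose_def)
    then show ?thesis
      using that(2) by (auto simp: poly_monomials_def keys_swap_monomial simp del: atLeastAtMost_iff)
  qed
  then show ?thesis
    using keys_coset_op_subset[OF assms(1), of q "poly_monomials n"] assms(2)
    by (simp add: poly_carrier_def)
qed

lemma SR_action_cls:
  assumes "x \<in> carrier (hecke_algebra n)"
  shows "SR_action n x (SR.cls n q) = SR.cls n (coset_op x q)"
proof -
  define q' where "q' = (SOME q'. q' \<in> SR.cls n q)"
  have "q' \<in> SR.cls n q" unfolding q'_def by (rule someI[of _ q]) (rule SR.cls_self)
  then have "q' - q \<in> nonchain_ideal n" by (simp only: SR_cls_iff)
  \<comment> \<open>For \<open>K\<close> the set of non-chain monomials, the closure condition of
    \<open>keys_coset_op_subset\<close> is vacuous.\<close>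
  then have "coset_op x (q' - q) \<in> nonchain_ideal n"
    unfolding nonchain_ideal_def mem_Collect_eq
    by (intro keys_coset_op_subset[OF assms]) auto
  moreover have "coset_op x q' - coset_op x q = coset_op x (q' - q)"
    using coset_op_add_right[of x q "q' - q"] by simp
  ultimately show ?thesis
    unfolding SR_action_def q'_def[symmetric] by (intro SR_cls_eq) simp
qed

lemma linear_maps_clsI:
  assumes "\<And>p. p \<in> poly_carrier n \<Longrightarrow> T (SR.cls n p) = SR.cls m (L p) \<and> L p \<in> poly_carrier m"
    and "\<And>p q. L (p + q) = L p + L q"
    and "\<And>c p. L (Poly_Mapping.single 0 c * p) = Poly_Mapping.single 0 c * L p"
  shows "T \<in> linear_maps (SR.Q n) (SR.Q m)"
  using assms
  by (auto simp: linear_maps_def SR.carrier_Q SR.Q_add SR.Q_smult SR.C_add SR.C_scale)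

lemma SR_action_algebra_action:
  "algebra_action (hecke_algebra n) (boolean_SR n :: ('f::field, 'f boolean_poly set) module) (SR_action n)"
  unfolding algebra_action_def boolean_SR_def
proof (intro conjI ballI allI)
  fix x assume x: "x \<in> carrier (hecke_algebra n)"
  show "SR_action n x \<in> linear_maps (SR.Q n) (SR.Q n)"
    by (rule linear_maps_clsI[where L = "coset_op x"])
      (simp_all add: SR_action_cls[OF x] coset_op_poly_carrier[OF x] coset_op_add_right coset_op_scale_right)
next
  fix v assume "v \<in> carrier (SR.Q n)"
  then show "SR_action n \<one>\<^bsub>hecke_algebra n\<^esub> v = v"
    by (auto simp: SR.carrier_Q hecke_one SR_action_cls hecke_word_carrier)
next
  fix x y :: "(word \<Rightarrow>\<^sub>0 'f) set" and v :: "'f boolean_poly set"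
  assume x: "x \<in> carrier (hecke_algebra n)" and y: "y \<in> carrier (hecke_algebra n)"
    and v: "v \<in> carrier (SR.Q n)"
  have xy: "x \<otimes>\<^bsub>hecke_algebra n\<^esub> y \<in> carrier (hecke_algebra n)"
    "x \<oplus>\<^bsub>hecke_algebra n\<^esub> y \<in> carrier (hecke_algebra n)"
    "coset_op (x \<oplus>\<^bsub>hecke_algebra n\<^esub> y) q = coset_op x q + coset_op y q" for q
    using x y by (auto simp: hecke_algebra_eq hecke.carrier_Q hecke.Q_mult hecke.Q_add
        hecke.C_mult hecke.C_add free_op_add)
  show "SR_action n (x \<otimes>\<^bsub>hecke_algebra n\<^esub> y) v = SR_action n x (SR_action n y v)"
    using v by (auto simp: SR.carrier_Q SR_action_cls x y xy coset_op_mult)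
  show "SR_action n (x \<oplus>\<^bsub>hecke_algebra n\<^esub> y) v = SR_action n x v \<oplus>\<^bsub>SR.Q n\<^esub> SR_action n y v"
    using v by (auto simp: SR.carrier_Q SR_action_cls x y xy SR.Q_add coset_op_poly_carrier)
next
  fix c and x :: "(word \<Rightarrow>\<^sub>0 'f) set" and v :: "'f boolean_poly set"
  assume x: "x \<in> carrier (hecke_algebra n)" and v: "v \<in> carrier (SR.Q n)"
  have cx: "c \<odot>\<^bsub>hecke_algebra n\<^esub> x \<in> carrier (hecke_algebra n)"
    "coset_op (c \<odot>\<^bsub>hecke_algebra n\<^esub> x) q = Poly_Mapping.single 0 c * coset_op x q" for q
    using x by (auto simp: hecke_algebra_eq hecke.carrier_Q hecke.Q_smult hecke.C_scale free_op_scale)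
  show "SR_action n (c \<odot>\<^bsub>hecke_algebra n\<^esub> x) v = c \<odot>\<^bsub>SR.Q n\<^esub> SR_action n x v"
    using v by (auto simp: SR.carrier_Q SR_action_cls x cx SR.Q_smult coset_op_poly_carrier)
qed

lemma multichain_poly_carrier:
  "M \<in> multichains n \<Longrightarrow> Poly_Mapping.single (multichain_monomial M) c \<in> poly_carrier n"
  by (auto simp: poly_carrier_def poly_monomials_def multichains_def simp del: atLeastAtMost_iff)

text \<open>The link between the prescribed formula and \<open>hecke_op\<close>; existence and
  uniqueness of the action both pass through it.\<close>

lemma cls_hecke_op_multichain:
  assumes "M \<in> multichains n" "i \<in> {1..<n}"
  shows "SR.cls n (hecke_op i (Poly_Mapping.single (multichain_monomial M) 1)) =
    (if chain_pos n M i > chain_pos n M (Suc i) then \<zero>\<^bsub>boolean_SR n\<^esub>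
     else if chain_pos n M i = chain_pos n M (Suc i) then y_monomial n M
     else y_monomial n (swap_chain i M) \<oplus>\<^bsub>boolean_SR n\<^esub> y_monomial n M)"
proof -
  have i: "i \<in> {1..n}" "Suc i \<in> {1..n}" using assms(2) by auto
  note less = chain_pos_less_iff[OF assms(1) i] chain_pos_less_iff[OF assms(1) i(2,1)]
  consider "chain_pos n M i < chain_pos n M (Suc i)" | "chain_pos n M i = chain_pos n M (Suc i)"
    | "chain_pos n M (Suc i) < chain_pos n M i" by linarith
  then show ?thesis
  proof cases
    case 1
    then show ?thesis
      using less assms swap_chain_multichains[OF assms]
      by (simp add: hecke_op_single chain_multichain_monomial[OF assms(1)] boolean_SR_def y_monomial_eq
          SR.Q_add multichain_poly_carrier swap_multichain_monomial)
  next
    case 2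
    then show ?thesis
      using less by (simp add: hecke_op_single chain_multichain_monomial[OF assms(1)] y_monomial_eq)
  next
    case 3
    then show ?thesis
      using less by (simp add: hecke_op_single boolean_SR_def SR.Q_zero)
  qed
qed

lemma boolean_hecke_action_SR_action:
  "boolean_hecke_action n (SR_action n :: (word \<Rightarrow>\<^sub>0 'f::field) set \<Rightarrow> _)"
  unfolding boolean_hecke_action_def
proof (intro conjI ballI SR_action_algebra_action)
  fix i M assume i: "i \<in> {1..<n}" and M: "M \<in> multichains n"
  have "hecke_gen n i \<in> carrier (hecke_algebra n :: ('f, (word \<Rightarrow>\<^sub>0 'f) set) module)"
    using i by (intro hecke_word_carrier) auto
  then have "SR_action n (hecke_gen n i) (y_monomial n M) =
      SR.cls n (hecke_op i (Poly_Mapping.single (multichain_monomial M) (1 :: 'f)))"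
    by (simp add: y_monomial_eq SR_action_cls)
  also note cls_hecke_op_multichain[OF M i]
  finally show "SR_action n (hecke_gen n i :: (word \<Rightarrow>\<^sub>0 'f) set) (y_monomial n M) =
        (if chain_pos n M i > chain_pos n M (Suc i) then \<zero>\<^bsub>boolean_SR n\<^esub>
         else if chain_pos n M i = chain_pos n M (Suc i) then y_monomial n M
         else y_monomial n (swap_chain i M) \<oplus>\<^bsub>boolean_SR n\<^esub> y_monomial n M)" .
qed

section \<open>The map into the next Stanley-Reisner ring\<close>

definition SR_iota :: "nat \<Rightarrow> 'f::field boolean_poly set \<Rightarrow> 'f boolean_poly set" where
  "SR_iota n v = SR.cls (Suc n) (SOME q. q \<in> v)"

text \<open>A non-chain monomial over [n] is a non-chain monomial over [n + 1], so a polynomial also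
  represents the image of its class.\<close>

lemma SR_iota_cls: "SR_iota n (SR.cls n q) = SR.cls (Suc n) q"
proof -
  define q' where "q' = (SOME q'. q' \<in> SR.cls n q)"
  have "q' \<in> SR.cls n q" unfolding q'_def by (rule someI[of _ q]) (rule SR.cls_self)
  then have "q' - q \<in> nonchain_ideal (Suc n)"
    using poly_monomials_mono[of n "Suc n"] by (auto simp: SR_cls_iff nonchain_ideal_def)
  then show ?thesis
    unfolding SR_iota_def q'_def[symmetric] by (intro SR_cls_eq) simp
qed

lemma boolean_iota_action_SR_iota: "boolean_iota_action n (SR_iota n)"
  unfolding boolean_iota_action_def boolean_SR_def
proof (intro conjI ballI)
  have "poly_carrier n \<subseteq> (poly_carrier (Suc n) :: 'a boolean_poly set)"
    using poly_monomials_mono[of n "Suc n"] by (auto simp: poly_carrier_def)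
  then show "SR_iota n \<in> linear_maps (SR.Q n) (SR.Q (Suc n) :: ('a, 'a boolean_poly set) module)"
    by (intro linear_maps_clsI[where L = "\<lambda>q. q"]) (auto simp: SR_iota_cls)
qed (simp add: y_monomial_eq SR_iota_cls)

section \<open>Morphisms of the 0-Hecke category\<close>

text \<open>The generating pairs of the Hom relation in terms of arbitrary words, which
  \<open>hecke_monoid_eq\<close> permits.\<close>

definition hecke_step :: "nat \<Rightarrow> nat \<Rightarrow> (word \<Rightarrow>\<^sub>0 'f::field) set rel" where
  "hecke_step n m =
     {(hecke_word m u, hecke_word m (u @ [j])) | u j. u \<in> lists {1..<m} \<and> j \<in> {n + 1..<m}}"

lemma hecke_hom_rel_eq:
  "(hecke_hom_rel n m :: (word \<Rightarrow>\<^sub>0 'f::field) set rel) = (hecke_step n m \<union> (hecke_step n m)\<inverse>)\<^sup>*"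
proof -
  have mult: "hecke_word m u \<otimes>\<^bsub>hecke_algebra m\<^esub> hecke_gen m j = (hecke_word m (u @ [j]) :: (word \<Rightarrow>\<^sub>0 'f) set)"
    if "u \<in> lists {1..<m}" "j \<in> {n + 1..<m}" for u j
    using that by (intro hecke_word_mult) auto
  have "{(x, x \<otimes>\<^bsub>hecke_algebra m\<^esub> hecke_gen m j) | x j. x \<in> hecke_monoid m \<and> j \<in> {n + 1..<m}} =
      (hecke_step n m :: (word \<Rightarrow>\<^sub>0 'f) set rel)"
    unfolding hecke_monoid_eq hecke_step_def using mult by fast
  then show ?thesis by (simp only: hecke_hom_rel_def Let_def)
qed

lemma hecke_hom_rel_sym: "(x, y) \<in> hecke_hom_rel n m \<Longrightarrow> (y, x) \<in> hecke_hom_rel n m"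
  unfolding hecke_hom_rel_eq by (metis rtrancl_converseI converse_Un converse_converse sup_commute converse_iff)

lemma hecke_hom_rel_trans:
  "(x, y) \<in> hecke_hom_rel n m \<Longrightarrow> (y, z) \<in> hecke_hom_rel n m \<Longrightarrow> (x, z) \<in> hecke_hom_rel n m"
  unfolding hecke_hom_rel_eq by (rule rtrancl_trans)

lemma hecke_class_self: "x \<in> hecke_class n m x"
  by (simp add: hecke_class_def hecke_hom_rel_eq)

lemma hecke_class_eq: "y \<in> hecke_class n m x \<Longrightarrow> hecke_class n m y = hecke_class n m x"
  unfolding hecke_class_def by (blast intro: hecke_hom_rel_sym hecke_hom_rel_trans)

text \<open>No j satisfies n + 1 \<le> j \<le> m - 1 here. This covers endomorphisms as well as one
  step of iota.\<close>

lemma hecke_class_trivial: "m \<le> Suc n \<Longrightarrow> hecke_class n m x = {x}"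
proof -
  assume "m \<le> Suc n"
  then have "hecke_step n m = ({} :: (word \<Rightarrow>\<^sub>0 'a) set rel)" by (auto simp: hecke_step_def)
  then show ?thesis by (simp add: hecke_class_def hecke_hom_rel_eq)
qed

lemma hecke_hom_eq: "n \<le> m \<Longrightarrow> hecke_hom n m = hecke_class n m ` hecke_monoid m"
  by (auto simp: hecke_hom_def quotient_def hecke_class_def)

lemma hecke_monoid_carrier: "x \<in> hecke_monoid n \<Longrightarrow> x \<in> carrier (hecke_algebra n)"
  unfolding hecke_monoid_eq using hecke_word_carrier by blast

lemma hecke_one_monoid: "\<one>\<^bsub>hecke_algebra n\<^esub> \<in> hecke_monoid n"
  unfolding hecke_monoid_eq hecke_one by (rule imageI) simp

lemma hecke_iota_hom: "n \<le> m \<Longrightarrow> hecke_iota n m \<in> hecke_hom n m"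
  unfolding hecke_iota_def by (simp add: hecke_hom_eq hecke_one_monoid)

text \<open>
  The assumption \<open>l \<le> m + 1\<close> makes the class of \<open>y\<close> a singleton; composites with endomorphisms
  and with one step of \<open>\<iota>\<close> are all that uniqueness of the action needs.
\<close>

lemma hecke_comp_class:
  assumes nm: "n \<le> m" "m \<le> l" "l \<le> Suc m"
    and y: "y \<in> (hecke_monoid l :: (word \<Rightarrow>\<^sub>0 'f::field) set set)" and x: "x \<in> hecke_monoid m"
  shows "hecke_comp n m l (hecke_class m l y) (hecke_class n m x) =
    hecke_class n l (y \<otimes>\<^bsub>hecke_algebra l\<^esub> hecke_incl l x)"
proof -
  let ?c = "\<lambda>z. y \<otimes>\<^bsub>hecke_algebra l\<^esub> hecke_incl l z"
  obtain u where u: "u \<in> lists {1..<l}" "y = hecke_word l u"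
    using y unfolding hecke_monoid_eq by blast
  have c: "?c (hecke_word m v) = hecke_word l (u @ v)" if "v \<in> lists {1..<m}" for v
  proof -
    have "v \<in> lists {1..<l}" using that nm(2) by auto
    then show ?thesis by (simp add: hecke_incl_word[OF nm(2)] hecke_word_mult[OF u(1)] u(2))
  qed
  \<comment> \<open>The extra letter j is appended on the right, so multiplication by y on the left
    turns a step into a step; the range of j only grows from m to l.\<close>
  have S: "(?c a, ?c b) \<in> hecke_step n l" if ab: "(a, b) \<in> hecke_step n m"
    for a b :: "(word \<Rightarrow>\<^sub>0 'f) set"
  proof -
    obtain v j where v: "v \<in> lists {1..<m}" "j \<in> {n + 1..<m}" "a = hecke_word m v" "b = hecke_word m (v @ [j])"
      using ab unfolding hecke_step_def by blast
    have "v @ [j] \<in> lists {1..<m}" using v(1,2) by auto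
    then have "?c a = hecke_word l (u @ v)" "?c b = hecke_word l ((u @ v) @ [j])"
      using c v by simp_all
    moreover have "u @ v \<in> lists {1..<l}" "j \<in> {n + 1..<l}" using u(1) v(1,2) nm(2) by auto
    ultimately show ?thesis unfolding hecke_step_def by blast
  qed
  have rel: "(?c x, ?c z) \<in> hecke_hom_rel n l" if "z \<in> hecke_class n m x" for z
  proof -
    have "(x, z) \<in> (hecke_step n m \<union> (hecke_step n m)\<inverse>)\<^sup>*"
      using that by (simp add: hecke_class_def hecke_hom_rel_eq)
    then show ?thesis
      unfolding hecke_hom_rel_eq
    proof induction
      case (step a b)
      then have "(?c a, ?c b) \<in> hecke_step n l \<union> (hecke_step n l)\<inverse>" using S[of a b] S[of b a] by blast
      with step.IH show ?case by (rule rtrancl_into_rtrancl)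
    qed simp
  qed
  have "hecke_class n l (?c z) = hecke_class n l (?c x)" if "z \<in> hecke_class n m x" for z
    by (rule hecke_class_eq) (use rel[OF that] in \<open>simp add: hecke_class_def\<close>)
  then have "(\<Union>z\<in>hecke_class n m x. hecke_class n l (?c z)) = (\<Union>z\<in>hecke_class n m x. hecke_class n l (?c x))"
    by (rule SUP_cong[OF refl])
  also have "\<dots> = hecke_class n l (?c x)"
    using hecke_class_self[of x n m] by blast
  finally show ?thesis
    by (simp add: hecke_comp_def hecke_class_trivial[OF nm(3)])
qed

section \<open>The module structure\<close>

text \<open>All sets in the monomials of \<open>q\<close> lie in [n], so they contain neither j nor
  j + 1, and the two indices tie.\<close>

lemma hecke_op_fixed:
  assumes q: "Poly_Mapping.keys q \<subseteq> graded_monomials g n" and j: "n < j"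
  shows "hecke_op j q = q"
  using q
proof (induction q rule: poly_mapping_keys_induct)
  case (single m c)
  then have m: "m \<in> poly_monomials n" "chain_monomial m" using graded_monomials_subset[of g n] by auto
  have "a \<le> n" if "A \<in> Poly_Mapping.keys m" "a \<in> A" for a A
    using m(1) that by (force simp: poly_monomials_def)
  then have "\<not> precedes m j b" "\<not> precedes m (Suc j) b" for b
    using j by (force simp: precedes_def)+
  then show ?case using m(2) by (simp add: hecke_op_single)
qed (simp_all add: hecke_op_add)

text \<open>Well-definedness on Hom([n],[m]): an appended letter j > n acts first, and it fixes
  \<open>q\<close>. Membership in the carrier is passed along the chain of steps in the same
  induction.\<close>

lemma coset_op_class:
  assumes x: "x \<in> hecke_class n m x0" and x0: "x0 \<in> carrier (hecke_algebra m)"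
    and q: "Poly_Mapping.keys q \<subseteq> graded_monomials g n"
  shows "x \<in> carrier (hecke_algebra m) \<and> coset_op x q = coset_op x0 q"
proof -
  have S: "a \<in> carrier (hecke_algebra m)" "b \<in> carrier (hecke_algebra m)" "coset_op b q = coset_op a q"
    if "(a, b) \<in> hecke_step n m" for a b
  proof -
    obtain u j where u: "u \<in> lists {1..<m}" "j \<in> {n + 1..<m}" "a = hecke_word m u" "b = hecke_word m (u @ [j])"
      using \<open>(a, b) \<in> hecke_step n m\<close> unfolding hecke_step_def by blast
    have "u @ [j] \<in> lists {1..<m}" using u(1,2) by auto
    then show "a \<in> carrier (hecke_algebra m)" "b \<in> carrier (hecke_algebra m)"
      unfolding u(3,4) using u(1) by (auto intro!: hecke_word_carrier simp del: in_lists_conv_set)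
    show "coset_op b q = coset_op a q"
      unfolding u(3,4) using hecke_op_fixed[OF q, of j] u(2) by simp
  qed
  have "(x0, x) \<in> (hecke_step n m \<union> (hecke_step n m)\<inverse>)\<^sup>*"
    using x by (simp add: hecke_class_def hecke_hom_rel_eq)
  then show ?thesis
  proof induction
    case (step a b)
    then show ?case using S[of a b] S[of b a] by auto
  qed (use x0 in simp)
qed

text \<open>For a morphism \<open>f\<close> and an element \<open>v\<close> of the graded piece
  neither choice matters: the lift is unique by \<open>graded_cls_inject\<close>, and all members of
  \<open>f\<close> act alike on it by \<open>coset_op_class\<close>.\<close>

definition graded_action ::
    "nat list \<Rightarrow> nat \<Rightarrow> nat \<Rightarrow> (word \<Rightarrow>\<^sub>0 'f::field) set set \<Rightarrow> 'f boolean_poly set \<Rightarrow> 'f boolean_poly set" where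
  "graded_action g n m f v = SR.cls m (coset_op (SOME x. x \<in> f)
     (SOME q. Poly_Mapping.keys q \<subseteq> graded_monomials g n \<and> SR.cls n q = v))"

text \<open>Stated for any nonempty set whose members agree on \<open>q\<close>, so that it applies
  directly to the union defining \<open>hecke_comp\<close>.\<close>

lemma graded_action_cls:
  assumes "f \<noteq> {}" "\<And>x. x \<in> f \<Longrightarrow> coset_op x q = r" and q: "Poly_Mapping.keys q \<subseteq> graded_monomials g n"
  shows "graded_action g n m f (SR.cls n q) = SR.cls m r"
proof -
  have "(SOME q'. Poly_Mapping.keys q' \<subseteq> graded_monomials g n \<and> SR.cls n q' = SR.cls n q) = q"
    by (rule some_equality) (use q graded_cls_inject in blast)+
  moreover have "(SOME x. x \<in> f) \<in> f" using assms(1) by (simp add: some_in_eq)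
  ultimately show ?thesis using assms(2) by (simp add: graded_action_def)
qed

lemma graded_action_class:
  assumes "x \<in> carrier (hecke_algebra m)" "Poly_Mapping.keys q \<subseteq> graded_monomials g n"
  shows "graded_action g n m (hecke_class n m x) (SR.cls n q) = SR.cls m (coset_op x q)"
proof (rule graded_action_cls[OF _ _ assms(2)])
  show "hecke_class n m x \<noteq> {}" using hecke_class_self by blast
  show "coset_op y q = coset_op x q" if "y \<in> hecke_class n m x" for y
    using coset_op_class[OF that assms] by simp
qed

lemma keys_coset_op_graded:
  assumes "x \<in> carrier (hecke_algebra m)" "Poly_Mapping.keys q \<subseteq> graded_monomials g n" "n \<le> m"
  shows "Poly_Mapping.keys (coset_op x q) \<subseteq> graded_monomials g m"
proof (rule keys_coset_op_subset[OF assms(1)])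
  show "Poly_Mapping.keys q \<subseteq> graded_monomials g m"
    using assms(2) graded_monomials_mono[OF assms(3)] by blast
qed (rule swap_graded_monomials)

lemma graded_action_iota:
  assumes "Poly_Mapping.keys q \<subseteq> graded_monomials g n"
  shows "graded_action g n m (hecke_iota n m) (SR.cls n q) = SR.cls m q"
  unfolding hecke_iota_def graded_action_class[OF hecke_monoid_carrier[OF hecke_one_monoid] assms]
  by (simp add: hecke_one)

lemma hecke_module_graded_action:
  "hecke_module (boolean_SR_graded g :: nat \<Rightarrow> ('f::field, 'f boolean_poly set) module) (graded_action g)"
proof (rule hecke_module.intro)
  fix n show "module (ring_of_type_algebra :: 'f ring) (boolean_SR_graded g n :: ('f, 'f boolean_poly set) module)"
    by (rule module_boolean_SR_graded)
next
  fix f :: "(word \<Rightarrow>\<^sub>0 'f) set set" and n m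
  assume f: "f \<in> hecke_hom n m"
  then have nm: "n \<le> m" by (auto simp: hecke_hom_def split: if_splits)
  obtain x where x: "f = hecke_class n m x" "x \<in> carrier (hecke_algebra m)"
    using f hecke_monoid_carrier unfolding hecke_hom_eq[OF nm] by blast
  note act = graded_action_class[OF x(2), where g = g and n = n, folded x(1)]
  note keys = keys_coset_op_graded[OF x(2) _ nm, where g = g]
  note poly = keys_graded_poly_carrier
  show "graded_action g n m f \<in> linear_maps (boolean_SR_graded g n) (boolean_SR_graded g m)"
    unfolding linear_maps_def
  proof (intro CollectI conjI ballI allI funcsetI)
    fix v assume "v \<in> carrier (boolean_SR_graded g n :: ('f, 'f boolean_poly set) module)"
    then obtain q where q: "v = SR.cls n q" "Poly_Mapping.keys q \<subseteq> graded_monomials g n"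
      by (auto simp: carrier_boolean_SR_graded)
    show "graded_action g n m f v \<in> carrier (boolean_SR_graded g m)"
      using q(2) by (simp add: q(1) act carrier_boolean_SR_graded keys)
    show "graded_action g n m f (c \<odot>\<^bsub>boolean_SR_graded g n\<^esub> v) = c \<odot>\<^bsub>boolean_SR_graded g m\<^esub> graded_action g n m f v" for c
      using q(2) poly[OF q(2)] poly[OF keys[OF q(2)]]
      by (simp add: q(1) act SR.Q_smult keys_scale_subset coset_op_scale_right)
    fix w assume "w \<in> carrier (boolean_SR_graded g n :: ('f, 'f boolean_poly set) module)"
    then obtain p where p: "w = SR.cls n p" "Poly_Mapping.keys p \<subseteq> graded_monomials g n"
      by (auto simp: carrier_boolean_SR_graded)
    show "graded_action g n m f (v \<oplus>\<^bsub>boolean_SR_graded g n\<^esub> w) =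
        graded_action g n m f v \<oplus>\<^bsub>boolean_SR_graded g m\<^esub> graded_action g n m f w"
      using q(2) p(2) poly[OF q(2)] poly[OF keys[OF q(2)]] poly[OF p(2)] poly[OF keys[OF p(2)]]
      by (simp add: q(1) p(1) act SR.Q_add keys_add_subset coset_op_add_right)
  qed
next
  fix n and v :: "'f boolean_poly set"
  assume "v \<in> carrier (boolean_SR_graded g n)"
  then obtain q where q: "v = SR.cls n q" "Poly_Mapping.keys q \<subseteq> graded_monomials g n"
    by (auto simp: carrier_boolean_SR_graded)
  show "graded_action g n n (hecke_iota n n) v = v"
    unfolding q(1) by (rule graded_action_iota[OF q(2)])
next
  fix f h :: "(word \<Rightarrow>\<^sub>0 'f) set set" and n m l and v :: "'f boolean_poly set"
  assume f: "f \<in> hecke_hom n m" and h: "h \<in> hecke_hom m l" and "v \<in> carrier (boolean_SR_graded g n)"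
  then obtain q where q: "v = SR.cls n q" "Poly_Mapping.keys q \<subseteq> graded_monomials g n"
    by (auto simp: carrier_boolean_SR_graded)
  have nm: "n \<le> m" and ml: "m \<le> l" using f h by (auto simp: hecke_hom_def split: if_splits)
  obtain x where x: "f = hecke_class n m x" "x \<in> carrier (hecke_algebra m)"
    using f hecke_monoid_carrier unfolding hecke_hom_eq[OF nm] by blast
  obtain y where y: "h = hecke_class m l y" "y \<in> carrier (hecke_algebra l)"
    using h hecke_monoid_carrier unfolding hecke_hom_eq[OF ml] by blast
  have keys: "Poly_Mapping.keys (coset_op x q) \<subseteq> graded_monomials g m"
    by (rule keys_coset_op_graded[OF x(2) q(2) nm])
  have "graded_action g n l (hecke_comp n m l h f) (SR.cls n q) = SR.cls l (coset_op y (coset_op x q))"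
  \<comment> \<open>The composite is handled as a union of classes, each member of which acts on
    \<open>q\<close> as x followed by y.\<close>
  proof (rule graded_action_cls[OF _ _ q(2)])
    show "hecke_comp n m l h f \<noteq> {}"
      unfolding hecke_comp_def x(1) y(1) using hecke_class_self by blast
    fix z assume "z \<in> hecke_comp n m l h f"
    then obtain x' y' where x': "x' \<in> f" and y': "y' \<in> h"
      and z: "z \<in> hecke_class n l (y' \<otimes>\<^bsub>hecke_algebra l\<^esub> hecke_incl l x')"
      unfolding hecke_comp_def by blast
    have X: "x' \<in> carrier (hecke_algebra m)" "coset_op x' q = coset_op x q"
      using coset_op_class[OF _ x(2) q(2)] x' x(1) by auto
    have Y: "y' \<in> carrier (hecke_algebra l)" "coset_op y' (coset_op x q) = coset_op y (coset_op x q)"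
      using coset_op_class[OF _ y(2) keys] y' y(1) by auto
    note I = hecke_incl_carrier[OF ml X(1)]
    have "y' \<otimes>\<^bsub>hecke_algebra l\<^esub> hecke_incl l x' \<in> carrier (hecke_algebra l)"
      using Y(1) I(1) by (auto simp: hecke_algebra_eq hecke.carrier_Q hecke.Q_mult hecke.C_mult)
    from coset_op_class[OF z this q(2)]
    show "coset_op z q = coset_op y (coset_op x q)"
      by (simp add: coset_op_mult[OF Y(1) I(1)] I(2) X(2) Y(2))
  qed
  then show "graded_action g n l (hecke_comp n m l h f) v = graded_action g m l h (graded_action g n m f v)"
    using graded_action_class[OF x(2) q(2)] graded_action_class[OF y(2) keys] by (simp add: q(1) x(1) y(1))
qed

lemma restricted_graded_action:
  "restricted_boolean_action g (graded_action g :: nat \<Rightarrow> nat \<Rightarrow> (word \<Rightarrow>\<^sub>0 'f::field) set set \<Rightarrow> _)"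
  unfolding restricted_boolean_action_def
proof (intro conjI allI)
  fix n
  have "graded_action g n n (hecke_class n n x) v = SR_action n x v"
    if "x \<in> hecke_monoid n" "v \<in> carrier (boolean_SR_graded g n)" for x and v :: "'f boolean_poly set"
    using that hecke_monoid_carrier[OF that(1)]
    by (auto simp: carrier_boolean_SR_graded graded_action_class SR_action_cls)
  then show "\<exists>\<rho>. boolean_hecke_action n \<rho> \<and> (\<forall>x\<in>hecke_monoid n. \<forall>v\<in>carrier (boolean_SR_graded g n).
      graded_action g n n (hecke_class n n x) v = (\<rho> x v :: 'f boolean_poly set))"
    using boolean_hecke_action_SR_action by blast
  have "graded_action g n (Suc n) (hecke_iota n (Suc n)) v = SR_iota n v"
    if "v \<in> carrier (boolean_SR_graded g n)" for v :: "'f boolean_poly set"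
    using that by (auto simp: carrier_boolean_SR_graded graded_action_iota SR_iota_cls)
  then show "\<exists>J. boolean_iota_action n J \<and> (\<forall>v\<in>carrier (boolean_SR_graded g n).
      graded_action g n (Suc n) (hecke_iota n (Suc n)) v = (J v :: 'f boolean_poly set))"
    using boolean_iota_action_SR_iota by blast
qed

section \<open>Uniqueness\<close>

text \<open>Used for the generators pi_i and for iota: a linear map on the classes over
  \<open>K\<close> is fixed by its values on monomials, and is compared there with a map
  \<open>L\<close> of polynomials.\<close>

lemma linear_maps_determined:
  fixes q :: "'f::field boolean_poly"
  assumes T: "T \<in> linear_maps (SR.Q n) (SR.Q m)"
    and K: "K \<subseteq> poly_monomials n"
    and gen: "\<And>k. k \<in> K \<Longrightarrow> T (SR.cls n (Poly_Mapping.single k 1)) = SR.cls m (L (Poly_Mapping.single k 1))"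
    and L: "\<And>p. p \<in> poly_carrier n \<Longrightarrow> L p \<in> poly_carrier m" "\<And>p q. L (p + q) = L p + L q"
      "\<And>c p. L (Poly_Mapping.single 0 c * p) = Poly_Mapping.single 0 c * L p"
    and q: "Poly_Mapping.keys q \<subseteq> K"
  shows "T (SR.cls n q) = SR.cls m (L q)"
proof -
  have C: "p \<in> poly_carrier n" if "Poly_Mapping.keys p \<subseteq> K" for p :: "'f boolean_poly"
    using that K by (auto simp: poly_carrier_def)
  have T_add: "T (SR.cls n (p + q)) = T (SR.cls n p) \<oplus>\<^bsub>SR.Q m\<^esub> T (SR.cls n q)"
    if "p \<in> poly_carrier n" "q \<in> poly_carrier n" for p q
    using T that by (auto simp: linear_maps_def SR.carrier_Q SR.Q_add[symmetric])
  have T_scale: "T (SR.cls n (Poly_Mapping.single 0 c * p)) = c \<odot>\<^bsub>SR.Q m\<^esub> T (SR.cls n p)"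
    if "p \<in> poly_carrier n" for c p
    using T that by (auto simp: linear_maps_def SR.carrier_Q SR.Q_smult[symmetric])
  \<comment> \<open>\<open>linear_maps\<close> has no clause for zero. That T sends zero to zero
    follows from scaling by 0, for which the value is first written as a class.\<close>
  have "T (SR.cls n 0) \<in> carrier (SR.Q m)"
    using T SR.C_zero[of n] by (auto simp: linear_maps_def SR.carrier_Q)
  then obtain r where r: "T (SR.cls n 0) = SR.cls m r" "r \<in> poly_carrier m"
    by (auto simp: SR.carrier_Q)
  show ?thesis
    using q
  proof (induction q rule: poly_mapping_keys_induct)
    case zero
    show ?case using T_scale[OF SR.C_zero, of 0] L(3)[of 0 0] r by (simp add: SR.Q_smult)
  next
    case (single k c)
    have k: "Poly_Mapping.single k (1 :: 'f) \<in> poly_carrier n" by (rule C) (use single in simp)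
    show ?case
      using T_scale[OF k, of c] gen[OF single] L(1)[OF k] L(3)[of c "Poly_Mapping.single k 1"]
      by (simp add: SR.Q_smult mult_single)
  next
    case (add p q)
    then show ?case using T_add[OF C C, of p q] L(1)[OF C, of p] L(1)[OF C, of q] by (simp add: L(2) SR.Q_add)
  qed
qed

text \<open>The formula on multichains fixes the generators, and multiplicativity fixes all words.
  Both claims go through one induction, as the next generator is known only on graded
  polynomials.\<close>

lemma boolean_hecke_action_word:
  fixes q :: "'f::field boolean_poly"
  assumes \<rho>: "boolean_hecke_action n \<rho>" and u: "u \<in> lists {1..<n}"
    and q: "Poly_Mapping.keys q \<subseteq> graded_monomials g n"
  shows "\<rho> (hecke_word n u) (SR.cls n q) = SR.cls n (foldr hecke_op u q)"
    and "Poly_Mapping.keys (foldr hecke_op u q) \<subseteq> graded_monomials g n"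
proof -
  have alg: "algebra_action (hecke_algebra n) (SR.Q n) \<rho>"
    using \<rho> by (simp add: boolean_hecke_action_def boolean_SR_def)
  have gen: "\<rho> (hecke_gen n i) (SR.cls n p) = SR.cls n (hecke_op i p)"
    if i: "i \<in> {1..<n}" and p: "Poly_Mapping.keys p \<subseteq> graded_monomials g n" for i p
  proof (rule linear_maps_determined[OF _ _ _ _ hecke_op_add hecke_op_scale p])
    have gi: "hecke_gen n i \<in> carrier (hecke_algebra n :: ('f, (word \<Rightarrow>\<^sub>0 'f) set) module)"
      using i by (intro hecke_word_carrier) auto
    then show "\<rho> (hecke_gen n i) \<in> linear_maps (SR.Q n) (SR.Q n)"
      using alg by (simp add: algebra_action_def)
    show "graded_monomials g n \<subseteq> poly_monomials n" using graded_monomials_subset by blast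
    fix k assume "k \<in> graded_monomials g n"
    then obtain M where M: "M \<in> multichains n" "k = multichain_monomial M"
      by (auto simp: graded_monomials_def)
    show "\<rho> (hecke_gen n i) (SR.cls n (Poly_Mapping.single k 1)) =
        SR.cls n (hecke_op i (Poly_Mapping.single k 1))"
      using \<rho> i M(1) unfolding M(2) cls_hecke_op_multichain[OF M(1) i] y_monomial_eq[symmetric]
      by (simp add: boolean_hecke_action_def)
  next
    fix p :: "'f boolean_poly" assume "p \<in> poly_carrier n"
    moreover have "hecke_gen n i \<in> carrier (hecke_algebra n :: ('f, (word \<Rightarrow>\<^sub>0 'f) set) module)"
      using i by (intro hecke_word_carrier) auto
    ultimately show "hecke_op i p \<in> poly_carrier n"
      using coset_op_poly_carrier[of "hecke_gen n i" n p] by simp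
  qed
  have "\<rho> (hecke_word n u) (SR.cls n q) = SR.cls n (foldr hecke_op u q) \<and>
    Poly_Mapping.keys (foldr hecke_op u q) \<subseteq> graded_monomials g n"
    using u
  proof (induction u rule: list.induct)
    case Nil
    have "\<rho> \<one>\<^bsub>hecke_algebra n\<^esub> (SR.cls n q) = SR.cls n q"
      using alg keys_graded_poly_carrier[OF q] by (simp add: algebra_action_def SR.carrier_Q)
    then show ?case using q by (simp add: hecke_one)
  next
    case (Cons i u)
    have i: "i \<in> {1..<n}" and u: "u \<in> lists {1..<n}" using Cons.prems by auto
    have IH: "\<rho> (hecke_word n u) (SR.cls n q) = SR.cls n (foldr hecke_op u q)"
      "Poly_Mapping.keys (foldr hecke_op u q) \<subseteq> graded_monomials g n"
      using Cons.IH[OF u] by auto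
    have w: "hecke_word n (i # u) = hecke_gen n i \<otimes>\<^bsub>hecke_algebra n\<^esub> (hecke_word n u :: (word \<Rightarrow>\<^sub>0 'f) set)"
      using hecke_word_mult[of "[i]" n u, where ?'a = 'f] i u by simp
    have c: "hecke_gen n i \<in> carrier (hecke_algebra n :: ('f, (word \<Rightarrow>\<^sub>0 'f) set) module)"
      "hecke_word n u \<in> carrier (hecke_algebra n :: ('f, (word \<Rightarrow>\<^sub>0 'f) set) module)"
      "SR.cls n q \<in> carrier (SR.Q n)"
      using i u keys_graded_poly_carrier[OF q] by (auto intro!: hecke_word_carrier simp: SR.carrier_Q)
    have "\<rho> (hecke_word n (i # u)) (SR.cls n q) = \<rho> (hecke_gen n i) (\<rho> (hecke_word n u) (SR.cls n q))"
      unfolding w using alg c by (simp add: algebra_action_def)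
    then show ?case
      using gen[OF i IH(2)] keys_hecke_op_subset[OF IH(2) swap_graded_monomials[OF _ i]] by (simp add: IH(1))
  qed
  then show "\<rho> (hecke_word n u) (SR.cls n q) = SR.cls n (foldr hecke_op u q)"
    "Poly_Mapping.keys (foldr hecke_op u q) \<subseteq> graded_monomials g n" by auto
qed

text \<open>Only single steps are prescribed; functoriality and the factorisation of iota_{n,m+1}
  through [m] give the general case.\<close>

lemma restricted_action_iota:
  fixes q :: "'f::field boolean_poly"
  assumes mod: "hecke_module (boolean_SR_graded g) act" and res: "restricted_boolean_action g act"
    and "n \<le> m" and q: "Poly_Mapping.keys q \<subseteq> graded_monomials g n"
  shows "act n m (hecke_iota n m) (SR.cls n q) = SR.cls m q"
  using \<open>n \<le> m\<close>
proof (induction m rule: dec_induct)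
  case base
  show ?case using hecke_module.act_id[OF mod] q by (simp add: carrier_boolean_SR_graded)
next
  case (step m)
  have qm: "Poly_Mapping.keys q \<subseteq> graded_monomials g m"
    using q graded_monomials_mono[of n m g] step.hyps(1) by auto
  have v: "SR.cls n q \<in> carrier (boolean_SR_graded g n)" "SR.cls m q \<in> carrier (boolean_SR_graded g m)"
    using q qm by (auto simp: carrier_boolean_SR_graded)
  obtain J where J: "boolean_iota_action m J"
    "act m (Suc m) (hecke_iota m (Suc m)) (SR.cls m q) = J (SR.cls m q)"
    using res v(2) unfolding restricted_boolean_action_def by meson
  have "J (SR.cls m q) = SR.cls (Suc m) q"
  proof (rule linear_maps_determined[where L = "\<lambda>q. q", OF _ _ _ _ refl refl qm])
    show "J \<in> linear_maps (SR.Q m) (SR.Q (Suc m))"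
      using J(1) by (simp add: boolean_iota_action_def boolean_SR_def)
    show "graded_monomials g m \<subseteq> poly_monomials m" using graded_monomials_subset by blast
    show "J (SR.cls m (Poly_Mapping.single k 1)) = SR.cls (Suc m) (Poly_Mapping.single k 1)"
      if "k \<in> graded_monomials g m" for k
      using that J(1) by (auto simp: graded_monomials_def boolean_iota_action_def y_monomial_eq)
    show "p \<in> poly_carrier (Suc m)" if "p \<in> poly_carrier m" for p :: "'f boolean_poly"
      using that poly_monomials_mono[of m "Suc m"] by (auto simp: poly_carrier_def)
  qed
  moreover have "hecke_comp n m (Suc m) (hecke_iota m (Suc m)) (hecke_iota n m) =
      (hecke_iota n (Suc m) :: (word \<Rightarrow>\<^sub>0 'f) set set)"
    unfolding hecke_iota_def using step.hyps(1)
    by (subst hecke_comp_class)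
      (simp_all add: hecke_one_monoid, simp add: hecke_one hecke_incl_word hecke_word_mult)
  moreover have "act n (Suc m) (hecke_comp n m (Suc m) (hecke_iota m (Suc m)) (hecke_iota n m)) (SR.cls n q) =
      act m (Suc m) (hecke_iota m (Suc m)) (act n m (hecke_iota n m) (SR.cls n q))"
    by (rule hecke_module.act_comp[OF mod]) (use step.hyps(1) v in \<open>simp_all add: hecke_iota_hom\<close>)
  ultimately show ?case using step.IH J(2) by simp
qed

lemma restricted_action_unique:
  assumes mod: "hecke_module (boolean_SR_graded g) act" and res: "restricted_boolean_action g act"
    and f: "f \<in> (hecke_hom n m :: (word \<Rightarrow>\<^sub>0 'f::field) set set set)" and v: "v \<in> carrier (boolean_SR_graded g n)"
  shows "act n m f v = graded_action g n m f v"
proof -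
  obtain q where q: "v = SR.cls n q" "Poly_Mapping.keys q \<subseteq> graded_monomials g n"
    using v by (auto simp: carrier_boolean_SR_graded)
  have nm: "n \<le> m" using f by (auto simp: hecke_hom_def split: if_splits)
  obtain x where x: "f = hecke_class n m x" "x \<in> hecke_monoid m"
    using f unfolding hecke_hom_eq[OF nm] by blast
  obtain u where u: "u \<in> lists {1..<m}" "x = hecke_word m u"
    using x(2) unfolding hecke_monoid_eq by blast
  have qm: "Poly_Mapping.keys q \<subseteq> graded_monomials g m"
    using q(2) graded_monomials_mono[OF nm] by blast
  then have vm: "SR.cls m q \<in> carrier (boolean_SR_graded g m)"
    by (auto simp: carrier_boolean_SR_graded)
  \<comment> \<open>With f factored as an endomorphism after iota, both factors are governed by
    \<open>restricted_boolean_action\<close>.\<close>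
  have "hecke_comp n m m (hecke_class m m x) (hecke_iota n m) = f"
    unfolding hecke_iota_def x(1) using nm x(2)
    by (subst hecke_comp_class) (simp_all add: hecke_one_monoid, simp add: hecke_one hecke_incl_word u(2) hecke_word_mult[OF u(1)])
  moreover have "act n m (hecke_comp n m m (hecke_class m m x) (hecke_iota n m)) v =
      act m m (hecke_class m m x) (act n m (hecke_iota n m) v)"
    by (rule hecke_module.act_comp[OF mod hecke_iota_hom[OF nm] _ v]) (simp add: hecke_hom_eq x(2))
  moreover have "act n m (hecke_iota n m) v = SR.cls m q"
    unfolding q(1) by (rule restricted_action_iota[OF mod res nm q(2)])
  moreover obtain \<rho> where \<rho>: "boolean_hecke_action m \<rho>"
    "act m m (hecke_class m m x) (SR.cls m q) = \<rho> x (SR.cls m q)"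
    using res vm x(2) unfolding restricted_boolean_action_def by meson
  moreover have "\<rho> x (SR.cls m q) = SR.cls m (foldr hecke_op u q)"
    unfolding u(2) by (rule boolean_hecke_action_word(1)[OF \<rho>(1) u(1) qm])
  moreover have "graded_action g n m f v = SR.cls m (foldr hecke_op u q)"
    unfolding q(1) x(1) using graded_action_class[OF hecke_monoid_carrier[OF x(2)] q(2)] by (simp add: u(2))
  ultimately show ?thesis by simp
qed

section \<open>Finite generation\<close>

definition initial_chain :: "nat list \<Rightarrow> nat set list" where
  "initial_chain g = map (\<lambda>r. {1..r}) g"

text \<open>For sorted g the least n such that [n] has multichains of multigrading g. An empty g
  admits the empty multichain already at n = 0, hence the default.\<close>

definition top_rank :: "nat list \<Rightarrow> nat" where
  "top_rank g = (if g = [] then 0 else last g)"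

lemma initial_chain_multichains:
  assumes "sorted g"
  shows "initial_chain g \<in> multichains (top_rank g)" "map card (initial_chain g) = g"
proof -
  have "r \<le> top_rank g" if "r \<in> set g" for r
    using assms that by (cases g rule: rev_cases) (auto simp: top_rank_def sorted_append)
  then have "set (initial_chain g) \<subseteq> Pow {1..top_rank g}"
    by (fastforce simp: initial_chain_def)
  moreover have "sorted_wrt (\<subseteq>) (initial_chain g)"
    using assms unfolding initial_chain_def sorted_wrt_map
    by (rule sorted_wrt_mono_rel[rotated]) auto
  ultimately show "initial_chain g \<in> multichains (top_rank g)"
    by (simp add: multichains_def)
  show "map card (initial_chain g) = g"
    by (simp add: initial_chain_def o_def)
qed

text \<open>Ensures that a principal injection from the degree of the generator reaches every [n] in
  which a multichain of this multigrading exists.\<close>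

lemma top_rank_le:
  assumes "M \<in> multichains n" "map card M = g"
  shows "top_rank g \<le> n"
proof (cases "M = []")
  case True
  then show ?thesis using assms(2) by (auto simp: top_rank_def)
next
  case False
  then have "last M \<subseteq> {1..n}" using assms(1) last_in_set[OF False] unfolding multichains_def by blast
  then have "card (last M) \<le> n" using card_mono[of "{1..n}" "last M"] by simp
  then show ?thesis using assms(2) False by (auto simp: top_rank_def last_map)
qed

text \<open>Descending from the maximum of A reaches every positive number below it.\<close>

lemma down_closed_eq_interval:
  fixes A :: "nat set"
  assumes "finite A" "0 \<notin> A" "\<And>i. 1 \<le> i \<Longrightarrow> Suc i \<in> A \<Longrightarrow> i \<in> A"
  shows "A = {1..card A}"
proof (cases "A = {}")
  case False
  define b where "b = Max A"
  have b: "b \<in> A" "\<And>a. a \<in> A \<Longrightarrow> a \<le> b" using assms(1) False by (simp_all add: b_def)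
  have low: "1 \<le> k \<Longrightarrow> k \<in> A" if "k \<le> b" for k
    using that
  proof (induction k rule: inc_induct)
    case (step k)
    show ?case using assms(3)[OF step.prems] step.IH by simp
  qed (rule b(1))
  have "1 \<le> a" if "a \<in> A" for a using assms(2) that by (cases a) auto
  then have "A \<subseteq> {1..b}" using b(2) unfolding subset_iff atLeastAtMost_iff by blast
  moreover have "{1..b} \<subseteq> A" using low unfolding subset_iff atLeastAtMost_iff by blast
  ultimately have "A = {1..b}" by (rule equalityI)
  then show ?thesis by simp
qed simp

lemma sum_list_less:
  fixes f g :: "'a \<Rightarrow> nat"
  assumes "\<And>x. x \<in> set xs \<Longrightarrow> f x \<le> g x" "\<exists>x\<in>set xs. f x < g x"
  shows "sum_list (map f xs) < sum_list (map g xs)"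
  using assms
proof (induction xs)
  case (Cons x xs)
  have le: "sum_list (map f xs) \<le> sum_list (map g xs)"
    by (rule sum_list_mono) (use Cons.prems(1) in auto)
  show ?case
  proof (cases "f x < g x")
    case False
    then have "sum_list (map f xs) < sum_list (map g xs)"
      by (intro Cons.IH) (use Cons.prems in auto)
    then show ?thesis using Cons.prems(1)[of x] by simp
  qed (use le in simp)
qed simp

text \<open>If A never contains i without i + 1, then s_i either fixes A or replaces i + 1 by
  i.\<close>

lemma sum_transpose_image:
  fixes A :: "nat set"
  assumes "finite A" "i \<in> A \<Longrightarrow> Suc i \<in> A"
  shows "\<Sum>(transpose i (Suc i) ` A) \<le> \<Sum>A"
    and "Suc i \<in> A \<Longrightarrow> i \<notin> A \<Longrightarrow> \<Sum>(transpose i (Suc i) ` A) < \<Sum>A"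
proof -
  have eq: "\<Sum>(transpose i (Suc i) ` A) = (\<Sum>a\<in>A. transpose i (Suc i) a)"
    by (rule sum.reindex_cong[OF inj_on_subset[OF inj_transpose]]) auto
  show strict: "\<Sum>(transpose i (Suc i) ` A) < \<Sum>A" if "Suc i \<in> A" "i \<notin> A"
    unfolding eq
    by (rule sum_strict_mono_ex1[OF assms(1)]) (use that in \<open>auto simp: transpose_def\<close>)
  have "transpose i (Suc i) ` A = A" if "i \<in> A \<longleftrightarrow> Suc i \<in> A"
    using that by (simp add: transpose_image_eq)
  then show "\<Sum>(transpose i (Suc i) ` A) \<le> \<Sum>A"
    using strict assms(2) by (cases "i \<in> A"; cases "Suc i \<in> A") auto
qed

lemma finitely_generated_graded_action:
  assumes g: "sorted g"
  shows "finitely_generated (boolean_SR_graded g :: nat \<Rightarrow> ('f::field, 'f boolean_poly set) module) (graded_action g)"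
proof -
  let ?V = "boolean_SR_graded g :: nat \<Rightarrow> ('f, 'f boolean_poly set) module"
  let ?N = "top_rank g"
  define y where "y n M = SR.cls n (Poly_Mapping.single (multichain_monomial M) (1 :: 'f))" for n M
  note M0 = initial_chain_multichains[OF g]
  have keys: "Poly_Mapping.keys (Poly_Mapping.single (multichain_monomial M) (c :: 'f)) \<subseteq> graded_monomials g n"
    if "M \<in> multichains n" "map card M = g" for n M c
    using that by (auto simp: graded_monomials_def)
  have all: "W n = carrier (?V n)" if W: "hecke_submodule ?V (graded_action g) W"
    and gen: "y ?N (initial_chain g) \<in> W ?N" for W n
  proof -
    have sub: "submodule (W n) (ring_of_type_algebra :: 'f ring) (?V n)" for n
      using W by (simp add: hecke_submodule_def)
    have act: "graded_action g n m f v \<in> W m" if "f \<in> hecke_hom n m" "v \<in> W n" for n m f v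
      using W that by (simp add: hecke_submodule_def)
    interpret W: submodule "W n" "ring_of_type_algebra :: 'f ring" "?V n" by (rule sub)
    have zero: "\<zero>\<^bsub>SR.Q n\<^esub> \<in> W n" using W.one_closed by simp
    have add: "a \<oplus>\<^bsub>SR.Q n\<^esub> b \<in> W n" if "a \<in> W n" "b \<in> W n" for a b
      using W.m_closed[OF that] by simp
    have smult: "c \<odot>\<^bsub>SR.Q n\<^esub> a \<in> W n" if "a \<in> W n" for c a
      using W.smult_closed[of c a] that by (simp add: ring_of_type_algebra_def)
    have y: "y n M \<in> W n" if "M \<in> multichains n" "map card M = g" for M
      using that
    \<comment> \<open>The measure adds up all elements of all sets in the multichain.\<close>
    proof (induction "sum_list (map \<Sum> M)" arbitrary: M rule: less_induct)
      case less
      note M = less.prems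
      have sets: "A \<subseteq> {1..n}" if "A \<in> set M" for A using M(1) that unfolding multichains_def by blast
      show ?case
      proof (cases "\<exists>i\<in>{1..<n}. precedes (multichain_monomial M) (Suc i) i")
        case True
        then obtain i where i: "i \<in> {1..<n}" "precedes (multichain_monomial M) (Suc i) i" by blast
        let ?M = "swap_chain i M"
        have M': "?M \<in> multichains n" "map card ?M = g"
          using swap_chain_multichains[OF M(1) i(1)] card_swap_chain[of i M] M(2) by simp_all
        have "\<not> precedes (multichain_monomial M) i (Suc i)"
          using precedes_asym[OF chain_multichain_monomial[OF M(1)] i(2)] .
        \<comment> \<open>M is a chain with a set that contains i + 1 but not i, so no set contains
          i alone; hence s_i lowers the sum of at least one set and raises none.\<close>
        then have up: "Suc i \<in> A" if "A \<in> set M" "i \<in> A" for A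
          using that unfolding precedes_multichain_monomial by blast
        have fin: "finite A" if "A \<in> set M" for A using sets[OF that] finite_subset by blast
        have "sum_list (map (\<lambda>A. \<Sum>(transpose i (Suc i) ` A)) M) < sum_list (map \<Sum> M)"
        proof (rule sum_list_less)
          show "\<Sum>(transpose i (Suc i) ` A) \<le> \<Sum>A" if "A \<in> set M" for A
            by (rule sum_transpose_image(1)[OF fin[OF that] up[OF that]])
          obtain A where A: "A \<in> set M" "Suc i \<in> A" "i \<notin> A"
            using i(2) unfolding precedes_multichain_monomial by blast
          show "\<exists>A\<in>set M. \<Sum>(transpose i (Suc i) ` A) < \<Sum>A"
            using sum_transpose_image(2)[OF fin[OF A(1)] up[OF A(1)] A(2,3)] A(1) by blast
        qed
        then have "sum_list (map \<Sum> ?M) < sum_list (map \<Sum> M)"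
          by (simp add: swap_chain_def o_def)
        from less.hyps[OF this M'] have yM': "y n ?M \<in> W n" .
        have up': "precedes (multichain_monomial ?M) i (Suc i)" "\<not> precedes (multichain_monomial ?M) (Suc i) i"
          using i(2) precedes_asym[OF chain_multichain_monomial[OF M(1)] i(2)]
          by (simp_all add: swap_multichain_monomial[symmetric])
        have gi: "[i] \<in> lists {1..<n}" using i(1) by simp
        have hi: "hecke_gen n i \<in> (hecke_monoid n :: (word \<Rightarrow>\<^sub>0 'f) set set)"
          unfolding hecke_monoid_eq using gi by (rule imageI)
        have "graded_action g n n (hecke_class n n (hecke_gen n i)) (y n ?M) =
            SR.cls n (hecke_op i (Poly_Mapping.single (multichain_monomial ?M) (1 :: 'f)))"
          unfolding y_def using graded_action_class[OF hecke_monoid_carrier[OF hi] keys[OF M', of 1]] by simp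
        also have "\<dots> = SR.cls n (Poly_Mapping.single (multichain_monomial M) 1 +
            Poly_Mapping.single (multichain_monomial ?M) (1 :: 'f))"
          using up' chain_multichain_monomial[OF M'(1)] by (simp add: hecke_op_single swap_multichain_monomial)
        finally have "SR.cls n (Poly_Mapping.single (multichain_monomial M) 1 +
            Poly_Mapping.single (multichain_monomial ?M) (1 :: 'f)) \<in> W n"
          using act[of "hecke_class n n (hecke_gen n i)" n n "y n ?M"] yM' hi by (simp add: hecke_hom_eq)
        \<comment> \<open>Subtracting y_M' from pi_i(y_M') = y_M + y_M', where M' = s_i(M), leaves
          y_M.\<close>
        from add[OF this smult[OF yM', of "-1"]] show ?thesis
          using multichain_poly_carrier[OF M(1), of "1 :: 'f"] multichain_poly_carrier[OF M'(1), of "1 :: 'f"]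
            multichain_poly_carrier[OF M'(1), of "- 1 :: 'f"]
          by (simp add: y_def SR.Q_smult SR.Q_add SR.C_add mult_single single_uminus)
      next
        case False
        \<comment> \<open>When i + 1 never precedes i, every set is an initial interval, and the
          multigrading then fixes M.\<close>
        have "A = {1..card A}" if "A \<in> set M" for A
        proof (rule down_closed_eq_interval)
          show "finite A" "0 \<notin> A" using sets[OF that] finite_subset by auto
          fix i assume i: "1 \<le> i" "Suc i \<in> A"
          have "i \<in> {1..<n}" using i sets[OF that] by auto
          then show "i \<in> A"
            using False i(2) that unfolding precedes_multichain_monomial by blast
        qed
        then have "M = map (\<lambda>A. {1..card A}) M" by (simp add: map_idI[symmetric])
        also have "\<dots> = initial_chain g" using M(2) by (auto simp: initial_chain_def)
        finally have "M = initial_chain g" .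
        moreover have "graded_action g ?N n (hecke_iota ?N n) (y ?N (initial_chain g)) = y n (initial_chain g)"
          unfolding y_def by (rule graded_action_iota[OF keys[OF M0]])
        moreover have "graded_action g ?N n (hecke_iota ?N n) (y ?N (initial_chain g)) \<in> W n"
          by (rule act[OF hecke_iota_hom[OF top_rank_le[OF M]] gen])
        ultimately show ?thesis by simp
      qed
    qed
    have "SR.cls n q \<in> W n" if "Poly_Mapping.keys q \<subseteq> graded_monomials g n" for q :: "'f boolean_poly"
    proof (rule SR.closed_contains_cls[OF _ zero add smult _ that])
      show "Poly_Mapping.single k c \<in> poly_carrier n" if "k \<in> graded_monomials g n" for k and c :: 'f
        by (rule keys_graded_poly_carrier[where g = g]) (use that in simp)
      show "SR.cls n (Poly_Mapping.single k (1 :: 'f)) \<in> W n" if "k \<in> graded_monomials g n" for k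
        using that y unfolding graded_monomials_def y_def by blast
    qed
    then have "carrier (?V n) \<subseteq> W n" by (auto simp: carrier_boolean_SR_graded)
    then show ?thesis using W.subset by simp
  qed
  have "y ?N (initial_chain g) \<in> carrier (?V ?N)"
    unfolding y_def carrier_boolean_SR_graded using keys[OF M0] by blast
  then show ?thesis
    unfolding finitely_generated_def using all
    by (intro exI[of _ "{(?N, y ?N (initial_chain g))}"]) auto
qed

theorem theorem12p1p2:
  fixes g :: "nat list"
  assumes "sorted g"
  shows "\<exists>act :: nat \<Rightarrow> nat \<Rightarrow> (word \<Rightarrow>\<^sub>0 'f::field) set set \<Rightarrow>
                 'f boolean_poly set \<Rightarrow> 'f boolean_poly set.
    hecke_module (boolean_SR_graded g) act \<and>
    restricted_boolean_action g act \<and>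
    (\<forall>act'. hecke_module (boolean_SR_graded g) act' \<and> restricted_boolean_action g act' \<longrightarrow>
       (\<forall>n m. \<forall>f\<in>hecke_hom n m. \<forall>v\<in>carrier (boolean_SR_graded g n).
          act' n m f v = act n m f v)) \<and>
    finitely_generated (boolean_SR_graded g) act"
  using hecke_module_graded_action restricted_graded_action restricted_action_unique
    finitely_generated_graded_action[OF assms]
  by (intro exI[of _ "graded_action g"]) blast

end
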